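(* Let $\mathcal M$ be a countable non-standard model of $\mathrm{Th}(\mathbb N)$. Then $SR(\mathcal M)>\omega$.
   Context: $\mathrm{Th}(\mathbb N)$ is true arithmetic, the complete theory of the standard model of arithmetic. $SR(\mathcal M)$, the (parameterless) Scott rank, is the least countable ordinal $\alpha$ such that every automorphism orbit of a finite tuple of $\mathcal M$ is definable without parameters by a $\Sigma^{\mathrm{in}}_\alpha$ formula of $L_{\omega_1\omega}$. *)

theory Defs
  imports Main "HOL-Library.Countable_Set"
begin

section \<open>Countable ordinals\<close>

text \<open>
  Every countable ordinal is the order type of a well-order whose field is some subset of
  the natural numbers, so the isomorphism classes of such well-orders are exactly the countable
  ordinals. Note that the relation \<open>ordIso\<close> holds only between well-orders.
\<close>

quotient_type cord = "nat rel" / partial: "\<lambda>r s :: nat rel. (r, s) \<in> ordIso"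
proof (rule part_equivpI)
  show "\<exists>r :: nat rel. (r, r) \<in> ordIso"
    using natLeq_Well_order ordIso_reflexive by blast
  show "symp (\<lambda>r s :: nat rel. (r, s) \<in> ordIso)"
    by (rule sympI) (rule ordIso_symmetric)
  show "transp (\<lambda>r s :: nat rel. (r, s) \<in> ordIso)"
    by (rule transpI) (rule ordIso_transitive)
qed

instantiation cord :: wellorder
begin

lift_definition less_eq_cord :: "cord \<Rightarrow> cord \<Rightarrow> bool" is "\<lambda>r s. (r, s) \<in> ordLeq"
  by (meson ordIso_ordLeq_trans ordIso_symmetric ordLeq_ordIso_trans)

lift_definition less_cord :: "cord \<Rightarrow> cord \<Rightarrow> bool" is "\<lambda>r s. (r, s) \<in> ordLess"
  by (meson ordIso_ordLess_trans ordIso_symmetric ordLess_ordIso_trans)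

instance
proof
  fix x y z :: cord
  show "x < y \<longleftrightarrow> x \<le> y \<and> \<not> y \<le> x"
    by transfer
      (meson not_ordLess_ordLeq ordIso_iff_ordLeq ordLess_imp_ordLeq ordLeq_Well_order_simp
        not_ordLeq_iff_ordLess)
  show "x \<le> x"
    by transfer (simp add: ordIso_iff_ordLeq)
  show "x \<le> z" if "x \<le> y" "y \<le> z"
    using that by transfer (rule ordLeq_transitive)
  show "x = y" if "x \<le> y" "y \<le> x"
    using that by transfer (simp add: ordIso_iff_ordLeq)
  show "x \<le> y \<or> y \<le> x"
    by transfer (meson ordIso_iff_ordLeq ordLeq_Well_order_simp ordLeq_total)
next
  fix P :: "cord \<Rightarrow> bool" and a :: cord
  assume step: "\<And>x. (\<And>y. y < x \<Longrightarrow> P y) \<Longrightarrow> P x"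
  have "wf (inv_image ordLess rep_cord)"
    by (rule wf_inv_image) (rule wf_ordLess)
  then show "P a"
  proof (induction a rule: wf_induct_rule)
    case (less x)
    show ?case
    proof (rule step)
      fix y assume "y < x"
      then have "(rep_cord y, rep_cord x) \<in> ordLess"
        by (simp add: less_cord.rep_eq)
      then show "P y"
        using less by (simp add: inv_image_def)
    qed
  qed
qed

end

instantiation cord :: zero
begin

lift_definition zero_cord :: cord is "{} :: nat rel"
  by (simp add: ordIso_reflexive)

instance ..

end

lift_definition omega :: cord is natLeq
  by (simp add: natLeq_Well_order ordIso_reflexive)


section \<open>Structures for the language of arithmetic\<close>

record 'a arith =
  azero :: 'a
  aone :: 'a
  aplus :: "'a \<Rightarrow> 'a \<Rightarrow> 'a"
  atimes :: "'a \<Rightarrow> 'a \<Rightarrow> 'a"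
  aless :: "'a \<Rightarrow> 'a \<Rightarrow> bool"

definition std_nat :: "nat arith" where
  "std_nat = \<lparr>azero = 0, aone = 1, aplus = (+), atimes = (*), aless = (<)\<rparr>"

definition isomorphism :: "'a arith \<Rightarrow> 'b arith \<Rightarrow> ('a \<Rightarrow> 'b) \<Rightarrow> bool" where
  "isomorphism M N f \<longleftrightarrow>
     bij f \<and>
     f (azero M) = azero N \<and>
     f (aone M) = aone N \<and>
     (\<forall>x y. f (aplus M x y) = aplus N (f x) (f y)) \<and>
     (\<forall>x y. f (atimes M x y) = atimes N (f x) (f y)) \<and>
     (\<forall>x y. aless M x y \<longleftrightarrow> aless N (f x) (f y))"

definition nonstandard :: "'a arith \<Rightarrow> bool" where
  "nonstandard M \<longleftrightarrow> \<not> (\<exists>f. isomorphism std_nat M f)"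

definition orbit :: "'a arith \<Rightarrow> 'a list \<Rightarrow> 'a list set" where
  "orbit M a = {map f a | f. isomorphism M M f}"


section \<open>Formulas of \<open>L\<^bsub>\<omega>\<^sub>1\<omega>\<^esub>\<close>\<close>

datatype tm = Var nat | Zero | One | Plus tm tm | Times tm tm

text \<open>
  Countable conjunctions and disjunctions are indexed by all natural numbers; finite ones are
  obtained by repeating a member, and the empty ones by repeating a valid or an unsatisfiable
  quantifier-free formula.
\<close>

datatype fm =
    Equal tm tm
  | Less tm tm
  | Neg fm
  | Conj fm fm
  | Disj fm fm
  | Exists nat fm
  | Forall nat fm
  | BigConj "nat \<Rightarrow> fm"
  | BigDisj "nat \<Rightarrow> fm"

primrec tm_vars :: "tm \<Rightarrow> nat set" where
  "tm_vars (Var x) = {x}"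
| "tm_vars Zero = {}"
| "tm_vars One = {}"
| "tm_vars (Plus s t) = tm_vars s \<union> tm_vars t"
| "tm_vars (Times s t) = tm_vars s \<union> tm_vars t"

primrec free_vars :: "fm \<Rightarrow> nat set" where
  "free_vars (Equal s t) = tm_vars s \<union> tm_vars t"
| "free_vars (Less s t) = tm_vars s \<union> tm_vars t"
| "free_vars (Neg p) = free_vars p"
| "free_vars (Conj p q) = free_vars p \<union> free_vars q"
| "free_vars (Disj p q) = free_vars p \<union> free_vars q"
| "free_vars (Exists x p) = free_vars p - {x}"
| "free_vars (Forall x p) = free_vars p - {x}"
| "free_vars (BigConj ps) = (\<Union>i. free_vars (ps i))"
| "free_vars (BigDisj ps) = (\<Union>i. free_vars (ps i))"

primrec finitary :: "fm \<Rightarrow> bool" where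
  "finitary (Equal s t) \<longleftrightarrow> True"
| "finitary (Less s t) \<longleftrightarrow> True"
| "finitary (Neg p) \<longleftrightarrow> finitary p"
| "finitary (Conj p q) \<longleftrightarrow> finitary p \<and> finitary q"
| "finitary (Disj p q) \<longleftrightarrow> finitary p \<and> finitary q"
| "finitary (Exists x p) \<longleftrightarrow> finitary p"
| "finitary (Forall x p) \<longleftrightarrow> finitary p"
| "finitary (BigConj ps) \<longleftrightarrow> False"
| "finitary (BigDisj ps) \<longleftrightarrow> False"

primrec quantifier_free :: "fm \<Rightarrow> bool" where
  "quantifier_free (Equal s t) \<longleftrightarrow> True"
| "quantifier_free (Less s t) \<longleftrightarrow> True"
| "quantifier_free (Neg p) \<longleftrightarrow> quantifier_free p"
| "quantifier_free (Conj p q) \<longleftrightarrow> quantifier_free p \<and> quantifier_free q"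
| "quantifier_free (Disj p q) \<longleftrightarrow> quantifier_free p \<and> quantifier_free q"
| "quantifier_free (Exists x p) \<longleftrightarrow> False"
| "quantifier_free (Forall x p) \<longleftrightarrow> False"
| "quantifier_free (BigConj ps) \<longleftrightarrow> (\<forall>i. quantifier_free (ps i))"
| "quantifier_free (BigDisj ps) \<longleftrightarrow> (\<forall>i. quantifier_free (ps i))"

primrec eval_tm :: "'a arith \<Rightarrow> (nat \<Rightarrow> 'a) \<Rightarrow> tm \<Rightarrow> 'a" where
  "eval_tm M v (Var x) = v x"
| "eval_tm M v Zero = azero M"
| "eval_tm M v One = aone M"
| "eval_tm M v (Plus s t) = aplus M (eval_tm M v s) (eval_tm M v t)"
| "eval_tm M v (Times s t) = atimes M (eval_tm M v s) (eval_tm M v t)"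

primrec sat :: "'a arith \<Rightarrow> (nat \<Rightarrow> 'a) \<Rightarrow> fm \<Rightarrow> bool" where
  "sat M v (Equal s t) \<longleftrightarrow> eval_tm M v s = eval_tm M v t"
| "sat M v (Less s t) \<longleftrightarrow> aless M (eval_tm M v s) (eval_tm M v t)"
| "sat M v (Neg p) \<longleftrightarrow> \<not> sat M v p"
| "sat M v (Conj p q) \<longleftrightarrow> sat M v p \<and> sat M v q"
| "sat M v (Disj p q) \<longleftrightarrow> sat M v p \<or> sat M v q"
| "sat M v (Exists x p) \<longleftrightarrow> (\<exists>d. sat M (v(x := d)) p)"
| "sat M v (Forall x p) \<longleftrightarrow> (\<forall>d. sat M (v(x := d)) p)"
| "sat M v (BigConj ps) \<longleftrightarrow> (\<forall>i. sat M v (ps i))"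
| "sat M v (BigDisj ps) \<longleftrightarrow> (\<exists>i. sat M v (ps i))"

definition theory_of :: "'a arith \<Rightarrow> fm set" where
  "theory_of M = {p. finitary p \<and> free_vars p = {} \<and> (\<forall>v. sat M v p)}"

definition is_model :: "'a arith \<Rightarrow> fm set \<Rightarrow> bool" where
  "is_model M T \<longleftrightarrow> (\<forall>p\<in>T. \<forall>v. sat M v p)"

definition true_arithmetic :: "fm set" where
  "true_arithmetic = theory_of std_nat"


section \<open>The infinitary hierarchy and the Scott rank\<close>

text \<open>
  A \<open>\<Sigma>\<^sub>0 = \<Pi>\<^sub>0\<close> formula is a finitary quantifier-free one; for \<open>\<alpha> > 0\<close> a
  \<open>\<Sigma>\<^sub>\<alpha>\<close> formula is a countable disjunction of formulas \<open>\<exists>x\<^sub>1\<dots>x\<^sub>k. \<psi>\<close> with \<open>\<psi>\<close> in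
  \<open>\<Pi>\<^sub>\<beta>\<close> for some \<open>\<beta> < \<alpha>\<close>, and dually for \<open>\<Pi>\<^sub>\<alpha>\<close>. The usual requirement that a formula has only
  finitely many free variables is imposed where the formula is used to define a relation; it is
  then inherited by all its subformulas, because each quantifier block is finite.
\<close>

inductive Sigma_in :: "cord \<Rightarrow> fm \<Rightarrow> bool" and Pi_in :: "cord \<Rightarrow> fm \<Rightarrow> bool" where
  Sigma_zero: "finitary p \<Longrightarrow> quantifier_free p \<Longrightarrow> Sigma_in 0 p"
| Pi_zero: "finitary p \<Longrightarrow> quantifier_free p \<Longrightarrow> Pi_in 0 p"
| Sigma_step: "(\<And>i. \<beta> i < \<alpha>) \<Longrightarrow> (\<And>i. Pi_in (\<beta> i) (ps i)) \<Longrightarrow>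
    Sigma_in \<alpha> (BigDisj (\<lambda>i. foldr Exists (xs i) (ps i)))"
| Pi_step: "(\<And>i. \<beta> i < \<alpha>) \<Longrightarrow> (\<And>i. Sigma_in (\<beta> i) (ps i)) \<Longrightarrow>
    Pi_in \<alpha> (BigConj (\<lambda>i. foldr Forall (xs i) (ps i)))"

definition defined_by :: "'a arith \<Rightarrow> nat \<Rightarrow> fm \<Rightarrow> 'a list set \<Rightarrow> bool" where
  "defined_by M n p R \<longleftrightarrow>
     free_vars p \<subseteq> {..<n} \<and> R = {map v [0..<n] | v. sat M v p}"

definition Scott_rank :: "'a arith \<Rightarrow> cord" where
  "Scott_rank M = (LEAST \<alpha>. \<forall>a. \<exists>p. Sigma_in \<alpha> p \<and> defined_by M (length a) p (orbit M a))"

end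

theory Submission
  imports Defs Complex_Main
begin

text \<open>
  By Scott's theorem some countable ordinal makes all orbits definable, so the Scott rank is a
  genuine minimum. Suppose it is at most \<open>\<omega>\<close>. Because \<open>M\<close> is a model of true arithmetic, any relation
  on the natural numbers that is first-order definable extends to \<open>M\<close> with the same first-order
  properties. For each \<open>n\<close> there is an arithmetical relation \<open>holds n i x\<close> such that, by overspill,
  two elements of \<open>M\<close> (coding tuples) with the same \<open>holds n\<close>-type over standard indices \<open>i\<close> satisfy the
  same infinitary \<open>\<Sigma>\<^sub>n\<close> formulas. Hence the orbit of a nonstandard \<open>a\<close> contains every element with
  the same standard \<open>V\<close>-type, for some arithmetical \<open>V\<close>. But map each number \<open>x > 0\<close> to the \<open>y < x\<close>
  whose \<open>V\<close>-type agrees with that of \<open>x\<close> for longest, and two-colour the numbers so that \<open>x\<close> and \<open>y\<close> differ: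
  since \<open>V\<close> has finitely many types up to each bound, a nonstandard \<open>a\<close> has the same standard
  \<open>V\<close>-type as its image, while the arithmetical colouring separates the two.
\<close>

section \<open>Countable ordinals\<close>

text \<open>The obstacle is that \<open>M\<close> need not be saturated, so elements of equal type
  cannot simply be moved back and forth. Overspill replaces saturation: what is realised up to every
  standard bound is realised up to a nonstandard one, provided that "up to \<open>k\<close>" is an
  arithmetical condition on \<open>k\<close>. This is why types are cut down to a single relation
  \<open>holds n\<close>, at the price of one \<open>n\<close> per quantifier block. A \<Sigma>
  formula at level \<omega> need not be preserved at any one finite \<open>n\<close>, but only a
  disjunct true of \<open>a\<close> matters, and that one lies at a finite level. The contradiction
  is one of complexity: automorphisms preserve all arithmetical relations of \<open>M\<close>,
  whatever their number of quantifiers, while \<open>V\<close> is one fixed relation, and the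
  colouring diagonalises against it. As \<open>holds\<close> speaks of codes of tuples,
  \<open>V\<close> is read off the least code whose entry 0 is the given element.\<close>

lemma rep_cord_Well_order: "Well_order (rep_cord \<alpha>)"
  using Quotient3_rep_reflp[OF Quotient3_cord, of \<alpha>] by (simp add: ordIso_def)

lemma rep_abs_cord: "Well_order r \<Longrightarrow> (rep_cord (abs_cord r), r) \<in> ordIso"
  using Quotient3_rep_abs[OF Quotient3_cord, of r] by (simp add: ordIso_reflexive)

definition segment :: "cord \<Rightarrow> nat \<Rightarrow> cord" where
  "segment \<alpha> a = abs_cord (Restr (rep_cord \<alpha>) (underS (rep_cord \<alpha>) a))"

lemma rep_segment:
  "(rep_cord (segment \<alpha> a), Restr (rep_cord \<alpha>) (underS (rep_cord \<alpha>) a)) \<in> ordIso"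
  unfolding segment_def by (intro rep_abs_cord Well_order_Restr rep_cord_Well_order)

lemma segment_less:
  assumes "a \<in> Field (rep_cord \<alpha>)"
  shows "segment \<alpha> a < \<alpha>"
  unfolding less_cord.rep_eq
  using underS_Restr_ordLess[OF rep_cord_Well_order, of \<alpha> a] rep_segment ordIso_ordLess_trans assms
  by blast

lemma segment_strict_mono:
  assumes "(a, b) \<in> rep_cord \<alpha>" "a \<noteq> b"
  shows "segment \<alpha> a < segment \<alpha> b"
proof -
  let ?r = "rep_cord \<alpha>"
  have wo: "wo_rel ?r"
    using rep_cord_Well_order by (simp add: wo_rel_def)
  have "underS ?r a \<subset> underS ?r b"
  proof
    show "underS ?r a \<subseteq> underS ?r b"
      using assms(1) wo_rel.TRANS[OF wo] wo_rel.ANTISYM[OF wo]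
      by (auto simp: underS_def trans_def antisym_def)
    show "underS ?r a \<noteq> underS ?r b"
      using assms by (auto simp: underS_def)
  qed
  then have "(Restr ?r (underS ?r a), Restr ?r (underS ?r b)) \<in> ordLess"
    using ofilter_subset_ordLess[OF rep_cord_Well_order wo_rel.underS_ofilter[OF wo]
        wo_rel.underS_ofilter[OF wo]] by blast
  then show ?thesis
    unfolding less_cord.rep_eq
    using rep_segment ordIso_ordLess_trans ordLess_ordIso_trans ordIso_symmetric by blast
qed

text \<open>Listing the predecessors of \<open>\<alpha>\<close> by the field of a representative
  reduces questions about their number to sets of naturals.\<close>

lemma below_cord_eq: "{\<beta>. \<beta> < \<alpha>} = segment \<alpha> ` Field (rep_cord \<alpha>)"
proof
  show "segment \<alpha> ` Field (rep_cord \<alpha>) \<subseteq> {\<beta>. \<beta> < \<alpha>}"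
    using segment_less by blast
  show "{\<beta>. \<beta> < \<alpha>} \<subseteq> segment \<alpha> ` Field (rep_cord \<alpha>)"
  proof
    fix \<beta> assume "\<beta> \<in> {\<beta>. \<beta> < \<alpha>}"
    then have "(rep_cord \<beta>, rep_cord \<alpha>) \<in> ordLess"
      by (simp add: less_cord.rep_eq)
    then obtain a where a: "a \<in> Field (rep_cord \<alpha>)"
      "(rep_cord \<beta>, Restr (rep_cord \<alpha>) (underS (rep_cord \<alpha>) a)) \<in> ordIso"
      using ordLess_iff_ordIso_Restr rep_cord_Well_order by metis
    have "(rep_cord \<beta>, rep_cord (segment \<alpha> a)) \<in> ordIso"
      using a(2) rep_segment ordIso_symmetric ordIso_transitive by blast
    then have "\<beta> = segment \<alpha> a"
      using Quotient3_rel_rep[OF Quotient3_cord] by blast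
    then show "\<beta> \<in> segment \<alpha> ` Field (rep_cord \<alpha>)"
      using a(1) by blast
  qed
qed

lemma countable_below_cord: "countable {\<beta> :: cord. \<beta> < \<alpha>}"
  by (simp add: below_cord_eq)

text \<open>The cardinal order is least among the well-orders of a set, so an order below
  \<open>natLeq\<close> has a finite field. Finiteness is what lets
  \<open>preserved_below_omega\<close> take a maximum over all smaller levels.\<close>

lemma finite_below_omega:
  assumes "\<alpha> < omega"
  shows "finite {\<beta> :: cord. \<beta> < \<alpha>}"
proof -
  have "(rep_cord \<alpha>, rep_cord omega) \<in> ordLess"
    using assms by (simp add: less_cord.rep_eq)
  moreover have "(rep_cord omega, natLeq) \<in> ordIso"
    unfolding omega_def by (rule rep_abs_cord[OF natLeq_Well_order])
  ultimately have "(rep_cord \<alpha>, natLeq) \<in> ordLess"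
    by (rule ordLess_ordIso_trans)
  moreover have "(card_of (Field (rep_cord \<alpha>)), rep_cord \<alpha>) \<in> ordLeq"
    by (rule card_of_least) (use rep_cord_Well_order in auto)
  ultimately have "(card_of (Field (rep_cord \<alpha>)), natLeq) \<in> ordLess"
    using ordLeq_ordLess_trans by blast
  then show ?thesis
    by (metis below_cord_eq finite_iff_ordLess_natLeq finite_imageI)
qed

text \<open>Burali-Forti: a countable \<open>cord\<close> would itself have an order type \<open>\<alpha>\<close> in \<open>cord\<close>, and would
  then embed into its own proper initial segment below \<open>\<alpha>\<close>.\<close>

lemma uncountable_cord: "uncountable (UNIV :: cord set)"
proof
  assume "countable (UNIV :: cord set)"
  then obtain g :: "cord \<Rightarrow> nat" where g: "inj g"
    by (auto simp: countable_def)
  define S where "S = {(g x, g y) | x y. x \<le> y}"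
  have field: "Field S = range g"
    by (auto simp: S_def Field_def)
  have S_iff: "(g x, g y) \<in> S \<longleftrightarrow> x \<le> y" for x y
    using g by (auto simp: S_def inj_eq)
  have "S - Id \<subseteq> inv_image {(x, y). x < y} (inv g)"
    using g by (auto simp: S_def)
  then have "wf (S - Id)"
    using wf_subset wf_inv_image[OF wf] by blast
  moreover have "Refl S"
    unfolding refl_on_def field using S_iff by (auto simp: S_def)
  moreover have "trans S"
  proof (rule transI)
    fix a b c assume "(a, b) \<in> S" "(b, c) \<in> S"
    then obtain x y z where "a = g x" "b = g y" "c = g z" "x \<le> y" "y \<le> z"
      using g by (auto simp: S_def inj_eq)
    then show "(a, c) \<in> S"
      using S_iff order_trans by blast
  qed
  moreover have "antisym S"
    unfolding antisym_def using g by (auto simp: S_def inj_eq)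
  moreover have "Total S"
    unfolding total_on_def field using S_iff by (auto simp: linear)
  ultimately have wo: "Well_order S"
    by (auto simp: order_on_defs S_def Field_def)
  define \<alpha> where "\<alpha> = abs_cord S"
  have "(S, rep_cord \<alpha>) \<in> ordIso"
    unfolding \<alpha>_def using rep_abs_cord[OF wo] by (rule ordIso_symmetric)
  then obtain h where h: "iso S (rep_cord \<alpha>) h"
    by (auto simp: ordIso_def)
  then have emb: "embed S (rep_cord \<alpha>) h"
    by (simp add: iso_def)
  define k where "k x = segment \<alpha> (h (g x))" for x
  have "k x < \<alpha>" for x
    unfolding k_def using embed_Field[OF emb] field by (intro segment_less) blast
  moreover have "k x < k y" if "x < y" for x y
    unfolding k_def
  proof (rule segment_strict_mono)
    have "compat S (rep_cord \<alpha>) h"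
      using embed_compat[OF emb] .
    then show "(h (g x), h (g y)) \<in> rep_cord \<alpha>"
      using that S_iff unfolding compat_def by (meson less_imp_le)
    have "inj_on h (Field S)"
      using embed_inj_on[OF wo emb] .
    then show "h (g x) \<noteq> h (g y)"
      using that g by (auto simp: field inj_on_eq_iff inj_eq)
  qed
  \<comment> \<open>\<open>\<alpha>\<close> itself satisfies \<open>k x < x\<close>. For the least
    such \<open>x\<close>, monotonicity gives \<open>k (k x) < k x\<close>, a smaller
    instance.\<close>
  ultimately show False
    using LeastI[of "\<lambda>x. k x < x" \<alpha>] not_less_Least[of _ "\<lambda>x. k x < x"] by blast
qed

text \<open>This is the uncountable cofinality of the first uncountable ordinal: the segments up to
  the \<open>f i\<close> have a countable union, which cannot exhaust \<open>cord\<close>.\<close>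

lemma countable_cord_bound:
  fixes f :: "nat \<Rightarrow> cord"
  obtains \<alpha> where "\<And>i. f i < \<alpha>"
proof -
  have "countable (\<Union>i. {\<beta>. \<beta> < f i} \<union> {f i})"
    by (simp add: countable_below_cord)
  then obtain \<alpha> where "\<alpha> \<notin> (\<Union>i. {\<beta>. \<beta> < f i} \<union> {f i})"
    using uncountable_cord by (metis UNIV_eq_I)
  then have "f i < \<alpha>" for i
    using linorder_less_linear[of \<alpha> "f i"] by blast
  then show ?thesis
    using that by blast
qed

section \<open>Semantics of infinitary formulas\<close>

lemma eval_tm_cong: "(\<And>x. x \<in> tm_vars t \<Longrightarrow> v x = w x) \<Longrightarrow> eval_tm M v t = eval_tm M w t"
  by (induction t) auto

lemma sat_cong: "(\<And>x. x \<in> free_vars p \<Longrightarrow> v x = w x) \<Longrightarrow> sat M v p \<longleftrightarrow> sat M w p"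
proof (induction p arbitrary: v w)
  case (Equal s t)
  then show ?case using eval_tm_cong[of s v w M] eval_tm_cong[of t v w M] by simp
next
  case (Less s t)
  then show ?case using eval_tm_cong[of s v w M] eval_tm_cong[of t v w M] by simp
next
  case (Neg p)
  then show ?case by (metis free_vars.simps(3) sat.simps(3))
next
  case (Conj p q)
  have "sat M v p = sat M w p" "sat M v q = sat M w q"
    by (rule Conj.IH, simp add: Conj.prems)+
  then show ?case by simp
next
  case (Disj p q)
  have "sat M v p = sat M w p" "sat M v q = sat M w q"
    by (rule Disj.IH, simp add: Disj.prems)+
  then show ?case by simp
next
  case (Exists x p)
  have "sat M (v(x := d)) p = sat M (w(x := d)) p" for d
    by (rule Exists.IH) (simp add: Exists.prems)
  then show ?case by simp
next
  case (Forall x p)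
  have "sat M (v(x := d)) p = sat M (w(x := d)) p" for d
    by (rule Forall.IH) (simp add: Forall.prems)
  then show ?case by simp
next
  case (BigConj ps)
  have "sat M v (ps i) = sat M w (ps i)" for i
    by (rule BigConj.IH) (use BigConj.prems in auto)
  then show ?case by simp
next
  case (BigDisj ps)
  have "sat M v (ps i) = sat M w (ps i)" for i
    by (rule BigDisj.IH) (use BigDisj.prems in auto)
  then show ?case by simp
qed

lemma free_vars_foldr_Exists [simp]: "free_vars (foldr Exists xs p) = free_vars p - set xs"
  by (induction xs) auto

lemma free_vars_foldr_Forall [simp]: "free_vars (foldr Forall xs p) = free_vars p - set xs"
  by (induction xs) auto

text \<open>A block is read as one change of the environment on a finite set of variables, so that
  later arguments treat it in a single step.\<close>

lemma sat_foldr_Exists: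
  "sat M v (foldr Exists xs p) \<longleftrightarrow> (\<exists>w. (\<forall>i. i \<notin> set xs \<longrightarrow> w i = v i) \<and> sat M w p)"
proof (induction xs arbitrary: v)
  case Nil
  show ?case
    by (auto simp: fun_eq_iff[symmetric])
next
  case (Cons x xs)
  have "(\<exists>d w. (\<forall>i. i \<notin> set xs \<longrightarrow> w i = (v(x := d)) i) \<and> sat M w p) \<longleftrightarrow>
    (\<exists>w. (\<forall>i. i \<notin> set (x # xs) \<longrightarrow> w i = v i) \<and> sat M w p)" (is "?l \<longleftrightarrow> ?r")
  proof
    assume ?l
    then show ?r
      by (metis fun_upd_apply list.set_intros(1) list.set_intros(2))
  next
    assume ?r
    then obtain w where w: "\<forall>i. i \<notin> set (x # xs) \<longrightarrow> w i = v i" "sat M w p"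
      by blast
    then have "\<forall>i. i \<notin> set xs \<longrightarrow> w i = (v(x := w x)) i"
      by simp
    then show ?l
      using w(2) by blast
  qed
  then show ?case
    by (simp add: Cons.IH)
qed

lemma sat_foldr_Forall:
  "sat M v (foldr Forall xs p) \<longleftrightarrow> \<not> sat M v (foldr Exists xs (Neg p))"
  by (induction xs arbitrary: v) auto

lemma eval_tm_isomorphism:
  "isomorphism M N f \<Longrightarrow> eval_tm N (\<lambda>i. f (v i)) t = f (eval_tm M v t)"
  by (induction t) (auto simp: isomorphism_def)

lemma sat_isomorphism:
  assumes f: "isomorphism M N f"
  shows "sat N (\<lambda>i. f (v i)) p \<longleftrightarrow> sat M v p"
proof (induction p arbitrary: v)
  case (Equal s t)
  have "inj f"
    using f by (simp add: isomorphism_def bij_is_inj)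
  then show ?case
    by (simp add: eval_tm_isomorphism[OF f] inj_eq)
next
  case (Less s t)
  then show ?case
    using f by (simp add: eval_tm_isomorphism[OF f]) (simp add: isomorphism_def)
next
  case (Exists x p)
  have surj: "surj f"
    using f by (simp add: isomorphism_def bij_is_surj)
  have upd: "(\<lambda>i. f (v i))(x := f d) = (\<lambda>i. f ((v(x := d)) i))" for d
    by auto
  show ?case
    unfolding sat.simps Exists.IH[symmetric] upd[symmetric] by (metis surj surjD)
next
  case (Forall x p)
  have surj: "surj f"
    using f by (simp add: isomorphism_def bij_is_surj)
  have upd: "(\<lambda>i. f (v i))(x := f d) = (\<lambda>i. f ((v(x := d)) i))" for d
    by auto
  show ?case
    unfolding sat.simps Forall.IH[symmetric] upd[symmetric] by (metis surj surjD)
qed auto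

section \<open>Every countable structure has a Scott rank\<close>

text \<open>The hierarchy admits \<open>Neg\<close> only at level 0, so a negation is pushed through
  quantifier blocks and infinitary connectives, which interchanges \<Sigma> and \<Pi> at the same
  level.\<close>

lemma negate_Sigma_Pi:
  shows "Sigma_in \<alpha> p \<Longrightarrow> \<exists>q. Pi_in \<alpha> q \<and> free_vars q = free_vars p \<and>
      (\<forall>(M :: 'a arith) v. sat M v q \<longleftrightarrow> \<not> sat M v p)"
    and "Pi_in \<alpha> p \<Longrightarrow> \<exists>q. Sigma_in \<alpha> q \<and> free_vars q = free_vars p \<and>
      (\<forall>(M :: 'a arith) v. sat M v q \<longleftrightarrow> \<not> sat M v p)"
proof (induction rule: Sigma_in_Pi_in.inducts)
  case (Sigma_zero p)
  then show ?case
    by (intro exI[of _ "Neg p"]) (simp add: Pi_zero)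
next
  case (Pi_zero p)
  then show ?case
    by (intro exI[of _ "Neg p"]) (simp add: Sigma_in_Pi_in.Sigma_zero)
next
  case (Sigma_step \<beta> \<alpha> ps xs)
  then obtain qs where qs: "\<And>i. Sigma_in (\<beta> i) (qs i)" "\<And>i. free_vars (qs i) = free_vars (ps i)"
    "\<And>i (M :: 'a arith) v. sat M v (qs i) \<longleftrightarrow> \<not> sat M v (ps i)"
    by metis
  show ?case
    by (rule exI[of _ "BigConj (\<lambda>i. foldr Forall (xs i) (qs i))"])
      (simp add: Sigma_in_Pi_in.Pi_step[OF Sigma_step.hyps(1) qs(1)] qs sat_foldr_Forall sat_foldr_Exists)
next
  case (Pi_step \<beta> \<alpha> ps xs)
  then obtain qs where qs: "\<And>i. Pi_in (\<beta> i) (qs i)" "\<And>i. free_vars (qs i) = free_vars (ps i)"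
    "\<And>i (M :: 'a arith) v. sat M v (qs i) \<longleftrightarrow> \<not> sat M v (ps i)"
    by metis
  show ?case
    by (rule exI[of _ "BigDisj (\<lambda>i. foldr Exists (xs i) (qs i))"])
      (auto simp add: Sigma_in_Pi_in.Sigma_step[OF Pi_step.hyps(1) qs(1)] qs sat_foldr_Forall sat_foldr_Exists)
qed

text \<open>\<open>Sigma_in\<close> is a rigid normal form, so closure properties are stated up to
  equivalence in \<open>M\<close>. The free variables are kept because \<open>defined_by\<close>
  restricts them.\<close>

definition Sigma_equiv :: "'a arith \<Rightarrow> cord \<Rightarrow> fm \<Rightarrow> bool" where
  "Sigma_equiv M \<alpha> p \<longleftrightarrow>
     (\<exists>q. Sigma_in \<alpha> q \<and> free_vars q = free_vars p \<and> (\<forall>v. sat M v q \<longleftrightarrow> sat M v p))"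

definition Pi_equiv :: "'a arith \<Rightarrow> cord \<Rightarrow> fm \<Rightarrow> bool" where
  "Pi_equiv M \<alpha> p \<longleftrightarrow>
     (\<exists>q. Pi_in \<alpha> q \<and> free_vars q = free_vars p \<and> (\<forall>v. sat M v q \<longleftrightarrow> sat M v p))"

lemma Sigma_equiv_Neg: "Pi_equiv M \<alpha> p \<Longrightarrow> Sigma_equiv M \<alpha> (Neg p)"
proof -
  assume "Pi_equiv M \<alpha> p"
  then obtain q where q: "Pi_in \<alpha> q" "free_vars q = free_vars p" "\<And>v. sat M v q \<longleftrightarrow> sat M v p"
    by (auto simp: Pi_equiv_def)
  obtain q' where "Sigma_in \<alpha> q'" "free_vars q' = free_vars q" "\<And>v. sat M v q' \<longleftrightarrow> \<not> sat M v q"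
    using negate_Sigma_Pi(2)[OF q(1)] by blast
  then show ?thesis
    unfolding Sigma_equiv_def using q by auto
qed

lemma Sigma_equiv_BigDisj_Exists:
  assumes "\<And>i. \<beta> i < \<alpha>" "\<And>i. Pi_equiv M (\<beta> i) (ps i)"
  shows "Sigma_equiv M \<alpha> (BigDisj (\<lambda>i. foldr Exists (xs i) (ps i)))"
proof -
  from assms(2) obtain qs where qs: "\<And>i. Pi_in (\<beta> i) (qs i)"
    "\<And>i. free_vars (qs i) = free_vars (ps i)" "\<And>i v. sat M v (qs i) \<longleftrightarrow> sat M v (ps i)"
    unfolding Pi_equiv_def by metis
  show ?thesis
    unfolding Sigma_equiv_def
    by (rule exI[of _ "BigDisj (\<lambda>i. foldr Exists (xs i) (qs i))"])
      (simp add: Sigma_step[OF assms(1) qs(1)] qs sat_foldr_Exists)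
qed

lemma Pi_equiv_BigConj:
  assumes "\<And>i. \<beta> i < \<alpha>" "\<And>i. Sigma_equiv M (\<beta> i) (ps i)"
  shows "Pi_equiv M \<alpha> (BigConj ps)"
proof -
  from assms(2) obtain qs where qs: "\<And>i. Sigma_in (\<beta> i) (qs i)"
    "\<And>i. free_vars (qs i) = free_vars (ps i)" "\<And>i v. sat M v (qs i) \<longleftrightarrow> sat M v (ps i)"
    unfolding Sigma_equiv_def by metis
  show ?thesis
    unfolding Pi_equiv_def
    using Pi_step[OF assms(1) qs(1), where xs = "\<lambda>_. []"]
    by (intro exI[of _ "BigConj qs"]) (simp add: qs)
qed

lemma Sigma_equiv_imp_Pi_equiv:
  assumes "Sigma_equiv M \<beta> p" "\<beta> < \<alpha>"
  shows "Pi_equiv M \<alpha> p"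
  using Pi_equiv_BigConj[of "\<lambda>_. \<beta>" \<alpha> M "\<lambda>_. p"] assms by (simp add: Pi_equiv_def)

lemma Pi_equiv_imp_Sigma_equiv:
  assumes "Pi_equiv M \<beta> p" "\<beta> < \<alpha>"
  shows "Sigma_equiv M \<alpha> p"
  using Sigma_equiv_BigDisj_Exists[of "\<lambda>_. \<beta>" \<alpha> M "\<lambda>_. p" "\<lambda>_. []"] assms
  by (simp add: Sigma_equiv_def)

lemma Sigma_equiv_cong:
  assumes "Sigma_equiv M \<alpha> p" "free_vars p = free_vars q" "\<And>v. sat M v p \<longleftrightarrow> sat M v q"
  shows "Sigma_equiv M \<alpha> q"
  using assms by (simp add: Sigma_equiv_def)

lemma larger_cord: obtains \<beta> :: cord where "\<alpha> < \<beta>"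
  using countable_cord_bound[of "\<lambda>_. \<alpha>"] by blast

lemma Sigma_equiv_mono:
  assumes "Sigma_equiv M \<beta> p" "\<beta> \<le> \<alpha>"
  shows "Sigma_equiv M \<alpha> p"
proof -
  obtain q where q: "Sigma_in \<beta> q" "free_vars q = free_vars p" "\<And>v. sat M v q \<longleftrightarrow> sat M v p"
    using assms(1) by (auto simp: Sigma_equiv_def)
  show ?thesis
    using q(1)
  proof cases
    \<comment> \<open>Level 0 is the exception to syntactic monotonicity: a quantifier-free formula
      has to be wrapped in a constant disjunction to reach a positive level.\<close>
    case Sigma_zero
    then show ?thesis
      using Pi_equiv_imp_Sigma_equiv[of M 0 p \<alpha>] assms(2) q Pi_zero assms(1)
      by (metis Pi_equiv_def order_le_less)
  next
    case (Sigma_step \<gamma> ps xs)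
    then have "Sigma_in \<alpha> q"
      using Sigma_in_Pi_in.Sigma_step[of \<gamma> \<alpha> ps xs] less_le_trans[OF _ assms(2)] by blast
    then show ?thesis
      using q by (auto simp: Sigma_equiv_def)
  qed
qed

lemma ex_Sigma_equiv_if_Pi_equiv: "Pi_equiv M \<beta> p \<Longrightarrow> \<exists>\<alpha>. Sigma_equiv M \<alpha> p"
  by (rule larger_cord[of \<beta>]) (blast intro: Pi_equiv_imp_Sigma_equiv)

lemma ex_Pi_equiv_if_Sigma_equiv: "Sigma_equiv M \<beta> p \<Longrightarrow> \<exists>\<alpha>. Pi_equiv M \<alpha> p"
  by (rule larger_cord[of \<beta>]) (blast intro: Sigma_equiv_imp_Pi_equiv)

text \<open>No rank is computed: \<open>countable_cord_bound\<close> always provides a level above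
  those of the immediate subformulas. Binary connectives become infinitary ones with a repeated
  member, and \<open>Forall\<close> a negated \<open>Exists\<close>.\<close>

lemma ex_Sigma_equiv: "\<exists>\<alpha>. Sigma_equiv M \<alpha> p"
proof (induction p)
  case (Equal s t)
  have "Sigma_in 0 (Equal s t)"
    by (simp add: Sigma_zero)
  then show ?case
    unfolding Sigma_equiv_def by blast
next
  case (Less s t)
  have "Sigma_in 0 (Less s t)"
    by (simp add: Sigma_zero)
  then show ?case
    unfolding Sigma_equiv_def by blast
next
  case (Neg p)
  then show ?case
    using ex_Pi_equiv_if_Sigma_equiv Sigma_equiv_Neg by blast
next
  case (Conj p q)
  then obtain \<beta>1 \<beta>2 where "Sigma_equiv M \<beta>1 p" "Sigma_equiv M \<beta>2 q"
    by blast
  define \<beta> where "\<beta> i = (if i = 0 then \<beta>1 else \<beta>2)" for i :: nat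
  define ps where "ps i = (if i = 0 then p else q)" for i :: nat
  have \<beta>: "Sigma_equiv M (\<beta> i) (ps i)" for i
    using \<open>Sigma_equiv M \<beta>1 p\<close> \<open>Sigma_equiv M \<beta>2 q\<close> by (simp add: \<beta>_def ps_def)
  obtain \<alpha> where "\<And>i. \<beta> i < \<alpha>"
    using countable_cord_bound[of \<beta>] by blast
  then have "Pi_equiv M \<alpha> (BigConj ps)"
    by (rule Pi_equiv_BigConj[OF _ \<beta>])
  then obtain \<gamma> where "Sigma_equiv M \<gamma> (BigConj ps)"
    using ex_Sigma_equiv_if_Pi_equiv by blast
  then have "Sigma_equiv M \<gamma> (Conj p q)"
    by (rule Sigma_equiv_cong) (auto simp: ps_def split: if_splits)
  then show ?case by blast
next
  case (Disj p q)
  then obtain \<beta>1 \<beta>2 where "Pi_equiv M \<beta>1 p" "Pi_equiv M \<beta>2 q"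
    using ex_Pi_equiv_if_Sigma_equiv by blast
  define \<beta> where "\<beta> i = (if i = 0 then \<beta>1 else \<beta>2)" for i :: nat
  define ps where "ps i = (if i = 0 then p else q)" for i :: nat
  have \<beta>: "Pi_equiv M (\<beta> i) (ps i)" for i
    using \<open>Pi_equiv M \<beta>1 p\<close> \<open>Pi_equiv M \<beta>2 q\<close> by (simp add: \<beta>_def ps_def)
  obtain \<alpha> where "\<And>i. \<beta> i < \<alpha>"
    using countable_cord_bound[of \<beta>] by blast
  then have "Sigma_equiv M \<alpha> (BigDisj (\<lambda>i. foldr Exists [] (ps i)))"
    by (rule Sigma_equiv_BigDisj_Exists[OF _ \<beta>])
  then have "Sigma_equiv M \<alpha> (Disj p q)"
    by (rule Sigma_equiv_cong) (auto simp: ps_def split: if_splits)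
  then show ?case by blast
next
  case (Exists x p)
  then obtain \<beta> where \<beta>: "Pi_equiv M \<beta> p"
    using ex_Pi_equiv_if_Sigma_equiv by blast
  obtain \<alpha> where "\<beta> < \<alpha>"
    using larger_cord by blast
  then have "Sigma_equiv M \<alpha> (BigDisj (\<lambda>_. foldr Exists [x] p))"
    using Sigma_equiv_BigDisj_Exists[of "\<lambda>_. \<beta>" \<alpha> M "\<lambda>_. p" "\<lambda>_. [x]"] \<beta> by blast
  then have "Sigma_equiv M \<alpha> (Exists x p)"
    by (rule Sigma_equiv_cong) auto
  then show ?case by blast
next
  case (Forall x p)
  then obtain \<beta> where \<beta>: "Pi_equiv M \<beta> (Neg p)"
    using ex_Pi_equiv_if_Sigma_equiv Sigma_equiv_Neg by meson
  obtain \<alpha> where "\<beta> < \<alpha>"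
    using larger_cord by blast
  then have "Sigma_equiv M \<alpha> (BigDisj (\<lambda>_. foldr Exists [x] (Neg p)))"
    using Sigma_equiv_BigDisj_Exists[of "\<lambda>_. \<beta>" \<alpha> M "\<lambda>_. Neg p" "\<lambda>_. [x]"] \<beta> by blast
  then obtain \<gamma> where "Sigma_equiv M \<gamma> (Neg (BigDisj (\<lambda>_. foldr Exists [x] (Neg p))))"
    using ex_Pi_equiv_if_Sigma_equiv Sigma_equiv_Neg by meson
  then have "Sigma_equiv M \<gamma> (Forall x p)"
    by (rule Sigma_equiv_cong) auto
  then show ?case by blast
next
  case (BigConj ps)
  then have ex: "\<forall>i. \<exists>\<alpha>. Sigma_equiv M \<alpha> (ps i)"
    by blast
  obtain \<beta> where \<beta>: "\<And>i. Sigma_equiv M (\<beta> i) (ps i)"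
    using choice[OF ex] by blast
  obtain \<alpha> where "\<And>i. \<beta> i < \<alpha>"
    using countable_cord_bound[of \<beta>] by blast
  then have "Pi_equiv M \<alpha> (BigConj ps)"
    using Pi_equiv_BigConj[of \<beta> \<alpha> M ps] \<beta> by blast
  then show ?case
    by (rule ex_Sigma_equiv_if_Pi_equiv)
next
  case (BigDisj ps)
  then have ex: "\<forall>i. \<exists>\<alpha>. Pi_equiv M \<alpha> (ps i)"
    using ex_Pi_equiv_if_Sigma_equiv by blast
  obtain \<beta> where \<beta>: "\<And>i. Pi_equiv M (\<beta> i) (ps i)"
    using choice[OF ex] by blast
  obtain \<alpha> where "\<And>i. \<beta> i < \<alpha>"
    using countable_cord_bound[of \<beta>] by blast
  then have "Sigma_equiv M \<alpha> (BigDisj (\<lambda>i. foldr Exists [] (ps i)))"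
    using Sigma_equiv_BigDisj_Exists[of \<beta> \<alpha> M ps "\<lambda>_. []"] \<beta> by blast
  then show ?case
    by auto
qed

section \<open>Complete infinitary types in countable structures, and Scott's theorem\<close>

definition tuple_env :: "'a arith \<Rightarrow> 'a list \<Rightarrow> nat \<Rightarrow> 'a" where
  "tuple_env M a = (\<lambda>i. if i < length a then a ! i else azero M)"

definition same_type :: "'a arith \<Rightarrow> 'a list \<Rightarrow> 'a list \<Rightarrow> bool" where
  "same_type M a b \<longleftrightarrow> length a = length b \<and>
     (\<forall>p. free_vars p \<subseteq> {..<length a} \<longrightarrow> (sat M (tuple_env M a) p \<longleftrightarrow> sat M (tuple_env M b) p))"

lemma same_type_sym: "same_type M a b \<Longrightarrow> same_type M b a"
  by (auto simp: same_type_def)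

text \<open>Each tuple of another type is excluded by one formula true of \<open>a\<close>. There
  are only countably many tuples, so the conjunction of these formulas is again a formula.\<close>

lemma type_isolated:
  fixes M :: "'a arith"
  assumes "countable (UNIV :: 'a set)"
  shows "\<exists>p. free_vars p \<subseteq> {..<length a} \<and> sat M (tuple_env M a) p \<and>
    (\<forall>b. length b = length a \<longrightarrow> sat M (tuple_env M b) p \<longrightarrow> same_type M a b)"
proof -
  define e :: "nat \<Rightarrow> 'a list" where "e = from_nat_into UNIV"
  have "countable (UNIV :: 'a list set)"
    using countable_lists[OF assms] by simp
  then have e: "range e = UNIV"
    unfolding e_def by (intro range_from_nat_into) auto
  have "\<exists>q. free_vars q \<subseteq> {..<length a} \<and> sat M (tuple_env M a) q \<and>
    (length b = length a \<longrightarrow> \<not> same_type M a b \<longrightarrow> \<not> sat M (tuple_env M b) q)" for b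
  proof (cases "length b = length a \<and> \<not> same_type M a b")
    case True
    then obtain q where q: "free_vars q \<subseteq> {..<length a}"
      "sat M (tuple_env M a) q \<noteq> sat M (tuple_env M b) q"
      unfolding same_type_def by metis
    show ?thesis
    proof (cases "sat M (tuple_env M a) q")
      case True
      then show ?thesis
        using q by blast
    next
      case False
      then show ?thesis
        using q by (intro exI[of _ "Neg q"]) auto
    qed
  next
    case False
    then show ?thesis
      by (intro exI[of _ "Equal Zero Zero"]) auto
  qed
  then have "\<forall>b. \<exists>q. free_vars q \<subseteq> {..<length a} \<and> sat M (tuple_env M a) q \<and>
    (length b = length a \<longrightarrow> \<not> same_type M a b \<longrightarrow> \<not> sat M (tuple_env M b) q)"
    by blast
  from choice[OF this] obtain q where q: "\<And>b. free_vars (q b) \<subseteq> {..<length a}"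
    "\<And>b. sat M (tuple_env M a) (q b)"
    "\<And>b. length b = length a \<Longrightarrow> \<not> same_type M a b \<Longrightarrow> \<not> sat M (tuple_env M b) (q b)"
    by blast
  have "same_type M a b"
    if "length b = length a" "sat M (tuple_env M b) (BigConj (\<lambda>i. q (e i)))" for b
  proof -
    obtain i where "b = e i"
      using e by blast
    then have "sat M (tuple_env M b) (q b)"
      using that(2) by simp
    then show ?thesis
      using q(3)[OF that(1)] by blast
  qed
  then show ?thesis
    using q by (intro exI[of _ "BigConj (\<lambda>i. q (e i))"]) auto
qed

lemma sat_tuple_env_snoc:
  assumes "free_vars p \<subseteq> {..<Suc (length a)}"
  shows "sat M (tuple_env M (a @ [c])) p \<longleftrightarrow> sat M ((tuple_env M a)(length a := c)) p"
  by (rule sat_cong) (use assms in \<open>auto simp: tuple_env_def nth_append\<close>)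

text \<open>The formula isolating \<open>a @ [c]\<close>, quantified over its last variable, belongs
  to the type of \<open>a\<close> and hence to that of \<open>b\<close>; a witness for
  \<open>b\<close> is the required \<open>d\<close>.\<close>

lemma same_type_extend:
  fixes M :: "'a arith"
  assumes "countable (UNIV :: 'a set)" "same_type M a b"
  shows "\<exists>d. same_type M (a @ [c]) (b @ [d])"
proof -
  have len: "length a = length b"
    using assms(2) by (simp add: same_type_def)
  obtain p where p: "free_vars p \<subseteq> {..<Suc (length a)}" "sat M (tuple_env M (a @ [c])) p"
    "\<And>b. length b = Suc (length a) \<Longrightarrow> sat M (tuple_env M b) p \<Longrightarrow> same_type M (a @ [c]) b"
    using type_isolated[OF assms(1), of "a @ [c]" M] by auto
  have "sat M (tuple_env M a) (Exists (length a) p)"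
    using p(2) sat_tuple_env_snoc[OF p(1)] by auto
  moreover have "free_vars (Exists (length a) p) \<subseteq> {..<length a}"
    using p(1) by auto
  ultimately have "sat M (tuple_env M b) (Exists (length a) p)"
    using assms(2) unfolding same_type_def by blast
  then obtain d where "sat M ((tuple_env M b)(length b := d)) p"
    using len by auto
  then have "sat M (tuple_env M (b @ [d])) p"
    using sat_tuple_env_snoc p(1) len by metis
  then show ?thesis
    using p(3)[of "b @ [d]"] len by auto
qed

lemma same_type_imp_orbit:
  fixes M :: "'a arith"
  assumes cnt: "countable (UNIV :: 'a set)" and ab: "same_type M a b"
  shows "b \<in> orbit M a"
proof -
  define e :: "nat \<Rightarrow> 'a" where "e = from_nat_into UNIV"
  have e: "range e = UNIV"
    unfolding e_def using cnt by (intro range_from_nat_into) auto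
  \<comment> \<open>Stage \<open>n\<close> places \<open>e n\<close> on the left with a partner
    \<open>y\<close> on the right, then \<open>e n\<close> on the right with a partner
    \<open>x\<close> on the left. The lists grow by two, and the limit is total and onto.\<close>
  have "\<exists>f. \<forall>n. (same_type M (fst (f n)) (snd (f n)) \<and> (n = 0 \<longrightarrow> f n = (a, b))) \<and>
    (\<exists>x y. f (Suc n) = (fst (f n) @ [e n, x], snd (f n) @ [y, e n]))"
  proof (rule dependent_nat_choice)
    show "\<exists>s. same_type M (fst s) (snd s) \<and> (0 = (0 :: nat) \<longrightarrow> s = (a, b))"
      using ab by (intro exI[of _ "(a, b)"]) auto
    fix s and n :: nat
    assume "same_type M (fst s) (snd s) \<and> (n = 0 \<longrightarrow> s = (a, b))"
    then obtain y where "same_type M (fst s @ [e n]) (snd s @ [y])"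
      using same_type_extend[OF cnt] by blast
    then obtain x where "same_type M ((snd s @ [y]) @ [e n]) ((fst s @ [e n]) @ [x])"
      using same_type_extend[OF cnt] same_type_sym by blast
    then have "same_type M (fst s @ [e n, x]) (snd s @ [y, e n])"
      using same_type_sym by fastforce
    then show "\<exists>s'. (same_type M (fst s') (snd s') \<and> (Suc n = 0 \<longrightarrow> s' = (a, b))) \<and>
        (\<exists>x y. s' = (fst s @ [e n, x], snd s @ [y, e n]))"
      by (intro exI[of _ "(fst s @ [e n, x], snd s @ [y, e n])"]) auto
  qed
  then obtain F where F: "\<And>n. same_type M (fst (F n)) (snd (F n))" "F 0 = (a, b)"
    "\<And>n. \<exists>x y. F (Suc n) = (fst (F n) @ [e n, x], snd (F n) @ [y, e n])"
    by blast
  define xs where "xs n = fst (F n)" for n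
  define ys where "ys n = snd (F n)" for n
  have same: "same_type M (xs n) (ys n)" for n
    using F(1) by (simp add: xs_def ys_def)
  have len: "length (ys n) = length (xs n)" for n
    using same[of n] by (simp add: same_type_def)
  have step: "\<exists>x y. xs (Suc n) = xs n @ [e n, x] \<and> ys (Suc n) = ys n @ [y, e n]" for n
    using F(3)[of n] by (auto simp: xs_def ys_def)
  have mono: "length (xs n) \<le> length (xs m) \<and>
      (\<forall>i < length (xs n). xs m ! i = xs n ! i \<and> ys m ! i = ys n ! i)" if "n \<le> m" for n m
    using that
  proof (induction m rule: dec_induct)
    case (step m)
    obtain x y where "xs (Suc m) = xs m @ [e m, x]" "ys (Suc m) = ys m @ [y, e m]"
      using \<open>\<And>n. \<exists>x y. xs (Suc n) = xs n @ [e n, x] \<and> ys (Suc n) = ys n @ [y, e n]\<close> by blast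
    then show ?case
      using step.IH by (auto simp: nth_append len)
  qed auto
  \<comment> \<open>\<open>R\<close> is the graph of the automorphism under construction, the union
    of the finite partial maps.\<close>
  define R where "R x y \<longleftrightarrow> (\<exists>n. \<exists>i < length (xs n). xs n ! i = x \<and> ys n ! i = y)" for x y
  \<comment> \<open>Three pairs are put into one stage because a binary operation involves two
    arguments and a value.\<close>
  have R3: "\<exists>n. \<exists>i < length (xs n). \<exists>j < length (xs n). \<exists>k < length (xs n).
      xs n ! i = x1 \<and> ys n ! i = y1 \<and> xs n ! j = x2 \<and> ys n ! j = y2 \<and> xs n ! k = x3 \<and> ys n ! k = y3"
    if "R x1 y1" "R x2 y2" "R x3 y3" for x1 y1 x2 y2 x3 y3
  proof -
    obtain n1 i n2 j n3 k where
      *: "i < length (xs n1)" "xs n1 ! i = x1" "ys n1 ! i = y1"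
         "j < length (xs n2)" "xs n2 ! j = x2" "ys n2 ! j = y2"
         "k < length (xs n3)" "xs n3 ! k = x3" "ys n3 ! k = y3"
      using \<open>R x1 y1\<close> \<open>R x2 y2\<close> \<open>R x3 y3\<close> unfolding R_def by blast
    define n where "n = n1 + n2 + n3"
    have "n1 \<le> n" "n2 \<le> n" "n3 \<le> n"
      by (auto simp: n_def)
    then have "i < length (xs n)" "j < length (xs n)" "k < length (xs n)"
      "xs n ! i = x1" "ys n ! i = y1" "xs n ! j = x2" "ys n ! j = y2" "xs n ! k = x3" "ys n ! k = y3"
      using * mono[of n1 n] mono[of n2 n] mono[of n3 n] by auto
    then show ?thesis
      by blast
  qed
  have preserve: "(x1 = x2) = (y1 = y2)" "(x1 = azero M) = (y1 = azero M)"
    "(x1 = aone M) = (y1 = aone M)" "(x3 = aplus M x1 x2) = (y3 = aplus M y1 y2)"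
    "(x3 = atimes M x1 x2) = (y3 = atimes M y1 y2)" "aless M x1 x2 = aless M y1 y2"
    if "R x1 y1" "R x2 y2" "R x3 y3" for x1 y1 x2 y2 x3 y3
  proof -
    obtain n i j k where *: "i < length (xs n)" "j < length (xs n)" "k < length (xs n)"
      "xs n ! i = x1" "ys n ! i = y1" "xs n ! j = x2" "ys n ! j = y2" "xs n ! k = x3" "ys n ! k = y3"
      using R3[OF \<open>R x1 y1\<close> \<open>R x2 y2\<close> \<open>R x3 y3\<close>] by blast
    have "sat M (tuple_env M (xs n)) p = sat M (tuple_env M (ys n)) p"
      if "free_vars p \<subseteq> {i, j, k}" for p
    proof -
      have "free_vars p \<subseteq> {..<length (xs n)}"
        using that *(1-3) by auto
      then show ?thesis
        using same[of n] by (simp add: same_type_def)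
    qed
    note this[of "Equal (Var i) (Var j)"] this[of "Equal (Var i) Zero"] this[of "Equal (Var i) One"]
      this[of "Equal (Var k) (Plus (Var i) (Var j))"] this[of "Equal (Var k) (Times (Var i) (Var j))"]
      this[of "Less (Var i) (Var j)"]
    then show "(x1 = x2) = (y1 = y2)" "(x1 = azero M) = (y1 = azero M)"
      "(x1 = aone M) = (y1 = aone M)" "(x3 = aplus M x1 x2) = (y3 = aplus M y1 y2)"
      "(x3 = atimes M x1 x2) = (y3 = atimes M y1 y2)" "aless M x1 x2 = aless M y1 y2"
      using * by (simp_all add: tuple_env_def len)
  qed
  have total: "\<exists>y. R x y" "\<exists>y. R y x" for x
  proof -
    obtain n where n: "e n = x"
      using e by (metis UNIV_I imageE)
    obtain u w where uw: "xs (Suc n) = xs n @ [x, u]" "ys (Suc n) = ys n @ [w, x]"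
      using step[of n] n by blast
    have "R x w" "R u x"
      unfolding R_def using uw len
      by (intro exI[of _ "Suc n"] exI[of _ "length (xs n)"], simp add: nth_append,
          intro exI[of _ "Suc n"] exI[of _ "Suc (length (xs n))"], simp add: nth_append)
    then show "\<exists>y. R x y" "\<exists>y. R y x"
      by blast+
  qed
  have "\<forall>x. \<exists>y. R x y"
    using total(1) by blast
  from choice[OF this] obtain f where f: "\<And>x. R x (f x)"
    by blast
  have f_eq: "f x = y" if "R x y" for x y
    using preserve(1)[OF f[of x] that that] by blast
  have "inj f"
    using preserve(1)[OF f f f] by (auto intro: injI)
  moreover have "surj f"
    using total(2) f_eq by (metis surjI)
  moreover have "f (azero M) = azero M" "f (aone M) = aone M"
    using preserve(2,3)[OF f f f] by blast+
  moreover have "f (aplus M x y) = aplus M (f x) (f y)" "f (atimes M x y) = atimes M (f x) (f y)"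
    "aless M x y = aless M (f x) (f y)" for x y
    using preserve(4-6)[OF f f f] by blast+
  ultimately have iso: "isomorphism M M f"
    by (simp add: isomorphism_def bij_def)
  have "map f a = b"
  proof (rule nth_equalityI)
    show "length (map f a) = length b"
      using ab by (simp add: same_type_def)
    fix i assume "i < length (map f a)"
    then have "R (a ! i) (b ! i)"
      unfolding R_def using F(2) by (intro exI[of _ "0 :: nat"] exI[of _ i]) (auto simp: xs_def ys_def)
    then show "map f a ! i = b ! i"
      using f_eq \<open>i < length (map f a)\<close> by simp
  qed
  then show ?thesis
    using iso by (auto simp: orbit_def)
qed

lemma orbit_definable:
  fixes M :: "'a arith"
  assumes cnt: "countable (UNIV :: 'a set)"
  shows "\<exists>p. defined_by M (length a) p (orbit M a)"
proof -
  obtain p where p: "free_vars p \<subseteq> {..<length a}" "sat M (tuple_env M a) p"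
    "\<And>b. length b = length a \<Longrightarrow> sat M (tuple_env M b) p \<Longrightarrow> same_type M a b"
    using type_isolated[OF cnt, of a M] by auto
  have "orbit M a = {map v [0..<length a] | v. sat M v p}"
  proof (intro equalityI subsetI)
    fix b assume "b \<in> orbit M a"
    then obtain f where f: "isomorphism M M f" "b = map f a"
      by (auto simp: orbit_def)
    have "sat M (\<lambda>i. f (tuple_env M a i)) p"
      using p(2) sat_isomorphism[OF f(1)] by blast
    moreover have "b = map (\<lambda>i. f (tuple_env M a i)) [0..<length a]"
      by (rule nth_equalityI) (auto simp: f(2) tuple_env_def)
    ultimately show "b \<in> {map v [0..<length a] | v. sat M v p}"
      by blast
  next
    fix b assume "b \<in> {map v [0..<length a] | v. sat M v p}"
    then obtain v where v: "b = map v [0..<length a]" "sat M v p"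
      by blast
    have "sat M (tuple_env M b) p \<longleftrightarrow> sat M v p"
      by (rule sat_cong) (use v p(1) in \<open>auto simp: tuple_env_def\<close>)
    then have "same_type M a b"
      using v p(3)[of b] by simp
    then show "b \<in> orbit M a"
      by (rule same_type_imp_orbit[OF cnt])
  qed
  then show ?thesis
    using p(1) by (auto simp: defined_by_def)
qed

text \<open>This keeps \<open>LEAST\<close> in \<open>Scott_rank\<close> from ranging over an empty
  set. The levels of the countably many orbits have a common bound, to which
  \<open>Sigma_equiv_mono\<close> raises each definition.\<close>

lemma ex_Scott_rank:
  fixes M :: "'a arith"
  assumes cnt: "countable (UNIV :: 'a set)"
  shows "\<exists>\<alpha>. \<forall>a. \<exists>p. Sigma_in \<alpha> p \<and> defined_by M (length a) p (orbit M a)"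
proof -
  define e :: "nat \<Rightarrow> 'a list" where "e = from_nat_into UNIV"
  have "countable (UNIV :: 'a list set)"
    using countable_lists[OF cnt] by simp
  then have e: "range e = UNIV"
    unfolding e_def by (intro range_from_nat_into) auto
  have "\<exists>\<alpha> p. Sigma_equiv M \<alpha> p \<and> defined_by M (length (e i)) p (orbit M (e i))" for i
    using orbit_definable[OF cnt, of M "e i"] ex_Sigma_equiv[of M] by blast
  then have "\<forall>i. \<exists>\<alpha>. \<exists>p. Sigma_equiv M \<alpha> p \<and> defined_by M (length (e i)) p (orbit M (e i))"
    by blast
  from choice[OF this] obtain \<beta> where
    \<beta>: "\<And>i. \<exists>p. Sigma_equiv M (\<beta> i) p \<and> defined_by M (length (e i)) p (orbit M (e i))"
    by blast
  obtain \<alpha> where \<alpha>: "\<And>i. \<beta> i < \<alpha>"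
    using countable_cord_bound[of \<beta>] by blast
  have "\<exists>p. Sigma_in \<alpha> p \<and> defined_by M (length a) p (orbit M a)" for a
  proof -
    obtain i where a: "a = e i"
      using e by blast
    obtain p where p: "Sigma_equiv M (\<beta> i) p" "defined_by M (length a) p (orbit M a)"
      using \<beta>[of i] unfolding a by blast
    have "Sigma_equiv M \<alpha> p"
      using Sigma_equiv_mono[OF p(1)] \<alpha>[of i] by simp
    then obtain q where "Sigma_in \<alpha> q" "free_vars q = free_vars p" "\<And>v. sat M v q \<longleftrightarrow> sat M v p"
      unfolding Sigma_equiv_def by blast
    then show ?thesis
      using p(2) by (auto simp: defined_by_def)
  qed
  then show ?thesis
    by blast
qed

section \<open>Arithmetical relations and transfer\<close>

lemma finite_tm_vars: "finite (tm_vars t)"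
  by (induction t) auto

lemma finite_free_vars: "finitary p \<Longrightarrow> finite (free_vars p)"
  by (induction p) (auto simp: finite_tm_vars)

locale true_arith_model =
  fixes M :: "'a arith"
  assumes model: "is_model M true_arithmetic"
begin

text \<open>\<open>P'\<close> is the extension of \<open>P\<close> to \<open>M\<close>. Speaking of
  pairs of predicates instead of formulas lets a first-order statement be transferred by decomposing
  both sides in parallel with introduction rules.\<close>

definition codefined :: "((nat \<Rightarrow> nat) \<Rightarrow> bool) \<Rightarrow> ((nat \<Rightarrow> 'a) \<Rightarrow> bool) \<Rightarrow> bool" where
  "codefined P P' \<longleftrightarrow>
     (\<exists>p. finitary p \<and> (\<forall>v. sat std_nat v p \<longleftrightarrow> P v) \<and> (\<forall>v. sat M v p \<longleftrightarrow> P' v))"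

lemma transfer:
  assumes "codefined (\<lambda>_. S) (\<lambda>_. S')"
  shows "S \<longleftrightarrow> S'"
proof -
  obtain p where p: "finitary p" "\<And>v. sat std_nat v p \<longleftrightarrow> S" "\<And>v. sat M v p \<longleftrightarrow> S'"
    using assms by (auto simp: codefined_def)
  obtain xs where xs: "set xs = free_vars p"
    using finite_list[OF finite_free_vars[OF p(1)]] by blast
  \<comment> \<open>The truth of \<open>p\<close> ignores the environment, yet \<open>p\<close> may
    have free variables; its existential closure is a sentence with the same truth value.\<close>
  define q where "q = foldr Exists xs p"
  have "finitary q"
    unfolding q_def using p(1) by (induction xs) auto
  moreover have "free_vars q = {}"
    by (simp add: q_def xs)
  moreover have "sat std_nat v q \<longleftrightarrow> S" for v
    unfolding q_def sat_foldr_Exists p(2) by blast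
  moreover have q: "sat M v q \<longleftrightarrow> S'" for v
    unfolding q_def sat_foldr_Exists p(3) by blast
  ultimately have "S \<Longrightarrow> q \<in> true_arithmetic" "\<not> S \<Longrightarrow> Neg q \<in> true_arithmetic"
    by (auto simp: true_arithmetic_def theory_of_def)
  then show ?thesis
    using model q unfolding is_model_def by (metis sat.simps(3))
qed

lemma rename_tm:
  "\<exists>t'. (\<forall>v. eval_tm std_nat v t' = eval_tm std_nat (\<lambda>i. v (\<sigma> i)) t) \<and>
    (\<forall>v. eval_tm M v t' = eval_tm M (\<lambda>i. v (\<sigma> i)) t)"
proof (induction t)
  case (Var x)
  show ?case by (rule exI[of _ "Var (\<sigma> x)"]) simp
next
  case Zero
  show ?case by (rule exI[of _ Zero]) simp
next
  case One
  show ?case by (rule exI[of _ One]) simp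
next
  case (Plus s t)
  then show ?case by (metis eval_tm.simps(4))
next
  case (Times s t)
  then show ?case by (metis eval_tm.simps(5))
qed

text \<open>\<open>\<sigma>\<close> may identify variables. Capture is avoided by first redirecting
  a bound variable to some \<open>z\<close> outside the image of the free variables.\<close>

lemma rename_fm:
  assumes "finitary p"
  shows "\<exists>q. finitary q \<and> (\<forall>v. sat std_nat v q \<longleftrightarrow> sat std_nat (\<lambda>i. v (\<sigma> i)) p) \<and>
    (\<forall>v. sat M v q \<longleftrightarrow> sat M (\<lambda>i. v (\<sigma> i)) p)"
  using assms
proof (induction p arbitrary: \<sigma>)
  case (Equal s t)
  obtain s' t' where
    "\<And>v. eval_tm std_nat v s' = eval_tm std_nat (\<lambda>i. v (\<sigma> i)) s"
    "\<And>v. eval_tm M v s' = eval_tm M (\<lambda>i. v (\<sigma> i)) s"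
    "\<And>v. eval_tm std_nat v t' = eval_tm std_nat (\<lambda>i. v (\<sigma> i)) t"
    "\<And>v. eval_tm M v t' = eval_tm M (\<lambda>i. v (\<sigma> i)) t"
    using rename_tm[of \<sigma> s] rename_tm[of \<sigma> t] by blast
  then show ?case
    by (intro exI[of _ "Equal s' t'"]) simp
next
  case (Less s t)
  obtain s' t' where
    "\<And>v. eval_tm std_nat v s' = eval_tm std_nat (\<lambda>i. v (\<sigma> i)) s"
    "\<And>v. eval_tm M v s' = eval_tm M (\<lambda>i. v (\<sigma> i)) s"
    "\<And>v. eval_tm std_nat v t' = eval_tm std_nat (\<lambda>i. v (\<sigma> i)) t"
    "\<And>v. eval_tm M v t' = eval_tm M (\<lambda>i. v (\<sigma> i)) t"
    using rename_tm[of \<sigma> s] rename_tm[of \<sigma> t] by blast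
  then show ?case
    by (intro exI[of _ "Less s' t'"]) simp
next
  case (Neg p)
  then obtain p' where "finitary p'"
    "\<And>v. sat std_nat v p' \<longleftrightarrow> sat std_nat (\<lambda>i. v (\<sigma> i)) p" "\<And>v. sat M v p' \<longleftrightarrow> sat M (\<lambda>i. v (\<sigma> i)) p"
    by (metis finitary.simps(3))
  then show ?case
    by (intro exI[of _ "Neg p'"]) simp
next
  case (Conj p q)
  then obtain p' q' where "finitary p'" "finitary q'"
    "\<And>v. sat std_nat v p' \<longleftrightarrow> sat std_nat (\<lambda>i. v (\<sigma> i)) p" "\<And>v. sat M v p' \<longleftrightarrow> sat M (\<lambda>i. v (\<sigma> i)) p"
    "\<And>v. sat std_nat v q' \<longleftrightarrow> sat std_nat (\<lambda>i. v (\<sigma> i)) q" "\<And>v. sat M v q' \<longleftrightarrow> sat M (\<lambda>i. v (\<sigma> i)) q"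
    by (metis finitary.simps(4))
  then show ?case
    by (intro exI[of _ "Conj p' q'"]) simp
next
  case (Disj p q)
  then obtain p' q' where "finitary p'" "finitary q'"
    "\<And>v. sat std_nat v p' \<longleftrightarrow> sat std_nat (\<lambda>i. v (\<sigma> i)) p" "\<And>v. sat M v p' \<longleftrightarrow> sat M (\<lambda>i. v (\<sigma> i)) p"
    "\<And>v. sat std_nat v q' \<longleftrightarrow> sat std_nat (\<lambda>i. v (\<sigma> i)) q" "\<And>v. sat M v q' \<longleftrightarrow> sat M (\<lambda>i. v (\<sigma> i)) q"
    by (metis finitary.simps(5))
  then show ?case
    by (intro exI[of _ "Disj p' q'"]) simp
next
  case (Exists x p)
  then have "finite (\<sigma> ` free_vars p)"
    by (simp add: finite_free_vars)
  then obtain z where z: "z \<notin> \<sigma> ` free_vars p"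
    using ex_new_if_finite infinite_UNIV_nat by blast
  obtain q where q: "finitary q"
    "\<And>v. sat std_nat v q \<longleftrightarrow> sat std_nat (\<lambda>i. v ((\<sigma>(x := z)) i)) p"
    "\<And>v. sat M v q \<longleftrightarrow> sat M (\<lambda>i. v ((\<sigma>(x := z)) i)) p"
    using Exists.IH[of "\<sigma>(x := z)"] Exists.prems by auto
  have "sat std_nat (v(z := d)) q \<longleftrightarrow> sat std_nat ((\<lambda>i. v (\<sigma> i))(x := d)) p" for v d
    unfolding q(2) by (rule sat_cong) (use z in auto)
  moreover have "sat M (v(z := d)) q \<longleftrightarrow> sat M ((\<lambda>i. v (\<sigma> i))(x := d)) p" for v d
    unfolding q(3) by (rule sat_cong) (use z in auto)
  ultimately show ?case
    using q(1) by (intro exI[of _ "Exists z q"]) simp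
next
  case (Forall x p)
  then have "finite (\<sigma> ` free_vars p)"
    by (simp add: finite_free_vars)
  then obtain z where z: "z \<notin> \<sigma> ` free_vars p"
    using ex_new_if_finite infinite_UNIV_nat by blast
  obtain q where q: "finitary q"
    "\<And>v. sat std_nat v q \<longleftrightarrow> sat std_nat (\<lambda>i. v ((\<sigma>(x := z)) i)) p"
    "\<And>v. sat M v q \<longleftrightarrow> sat M (\<lambda>i. v ((\<sigma>(x := z)) i)) p"
    using Forall.IH[of "\<sigma>(x := z)"] Forall.prems by auto
  have "sat std_nat (v(z := d)) q \<longleftrightarrow> sat std_nat ((\<lambda>i. v (\<sigma> i))(x := d)) p" for v d
    unfolding q(2) by (rule sat_cong) (use z in auto)
  moreover have "sat M (v(z := d)) q \<longleftrightarrow> sat M ((\<lambda>i. v (\<sigma> i))(x := d)) p" for v d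
    unfolding q(3) by (rule sat_cong) (use z in auto)
  ultimately show ?case
    using q(1) by (intro exI[of _ "Forall z q"]) simp
qed auto

section \<open>First-order closure properties of codefined pairs\<close>

lemma codefined_rename:
  assumes "codefined P P'"
  shows "codefined (\<lambda>v. P (\<lambda>i. v (\<sigma> i))) (\<lambda>v. P' (\<lambda>i. v (\<sigma> i)))"
proof -
  obtain p where p: "finitary p" "\<And>v. sat std_nat v p \<longleftrightarrow> P v" "\<And>v. sat M v p \<longleftrightarrow> P' v"
    using assms by (auto simp: codefined_def)
  show ?thesis
    using rename_fm[OF p(1), of \<sigma>] by (auto simp: codefined_def p)
qed

lemma codefined_not: "codefined P P' \<Longrightarrow> codefined (\<lambda>v. \<not> P v) (\<lambda>v. \<not> P' v)"
  unfolding codefined_def by (metis finitary.simps(3) sat.simps(3))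

lemma codefined_conj:
  "codefined P P' \<Longrightarrow> codefined Q Q' \<Longrightarrow> codefined (\<lambda>v. P v \<and> Q v) (\<lambda>v. P' v \<and> Q' v)"
  unfolding codefined_def by (metis finitary.simps(4) sat.simps(4))

lemma codefined_disj:
  "codefined P P' \<Longrightarrow> codefined Q Q' \<Longrightarrow> codefined (\<lambda>v. P v \<or> Q v) (\<lambda>v. P' v \<or> Q' v)"
  unfolding codefined_def by (metis finitary.simps(5) sat.simps(5))

lemma codefined_imp:
  "codefined P P' \<Longrightarrow> codefined Q Q' \<Longrightarrow> codefined (\<lambda>v. P v \<longrightarrow> Q v) (\<lambda>v. P' v \<longrightarrow> Q' v)"
  using codefined_disj[OF codefined_not, of P P' Q Q'] by simp

lemma codefined_iff:
  "codefined P P' \<Longrightarrow> codefined Q Q' \<Longrightarrow> codefined (\<lambda>v. P v \<longleftrightarrow> Q v) (\<lambda>v. P' v \<longleftrightarrow> Q' v)"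
  unfolding iff_conv_conj_imp by (intro codefined_conj codefined_imp)

text \<open>Environments are treated as de Bruijn contexts, so that these rules need no freshness
  side conditions.\<close>

lemma codefined_ex:
  assumes "codefined (\<lambda>v. P (\<lambda>i. v (Suc i)) (v 0)) (\<lambda>v. P' (\<lambda>i. v (Suc i)) (v 0))"
  shows "codefined (\<lambda>v. \<exists>x. P v x) (\<lambda>v. \<exists>x. P' v x)"
proof -
  obtain q where q: "finitary q" "\<And>v. sat std_nat v q \<longleftrightarrow> P (\<lambda>i. v (Suc i)) (v 0)"
    "\<And>v. sat M v q \<longleftrightarrow> P' (\<lambda>i. v (Suc i)) (v 0)"
    using assms by (auto simp: codefined_def)
  \<comment> \<open>The renaming below sends 0 to \<open>z\<close> and \<open>Suc i\<close> to
    \<open>i\<close>, so \<open>z\<close> must differ from every \<open>i\<close> with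
    \<open>Suc i\<close> free in \<open>q\<close>.\<close>
  have "finite ((\<lambda>i. i - 1) ` free_vars q)"
    by (simp add: finite_free_vars q(1))
  then obtain z where "z \<notin> (\<lambda>i. i - 1) ` free_vars q"
    using ex_new_if_finite infinite_UNIV_nat by blast
  then have z: "Suc z \<notin> free_vars q"
    by force
  obtain r where r: "finitary r" "\<And>v. sat std_nat v r \<longleftrightarrow> sat std_nat (\<lambda>i. v (case_nat z id i)) q"
    "\<And>v. sat M v r \<longleftrightarrow> sat M (\<lambda>i. v (case_nat z id i)) q"
    using rename_fm[OF q(1)] by blast
  have "sat std_nat (v(z := d)) r \<longleftrightarrow> sat std_nat (case_nat d v) q" for v d
    unfolding r(2) by (rule sat_cong) (use z in \<open>auto split: nat.splits\<close>)
  moreover have "sat M (v(z := d)) r \<longleftrightarrow> sat M (case_nat d v) q" for v d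
    unfolding r(3) by (rule sat_cong) (use z in \<open>auto split: nat.splits\<close>)
  ultimately show ?thesis
    unfolding codefined_def using r(1) by (intro exI[of _ "Exists z r"]) (simp add: q)
qed

lemma codefined_all:
  assumes "codefined (\<lambda>v. P (\<lambda>i. v (Suc i)) (v 0)) (\<lambda>v. P' (\<lambda>i. v (Suc i)) (v 0))"
  shows "codefined (\<lambda>v. \<forall>x. P v x) (\<lambda>v. \<forall>x. P' v x)"
  using codefined_not[OF codefined_ex, of "\<lambda>v x. \<not> P v x" "\<lambda>v x. \<not> P' v x"] codefined_not[OF assms]
  by simp

text \<open>A function is handled through its graph: slot 0 holds the value and the arguments are
  shifted, as \<open>codefined_ex\<close> expects.\<close>

definition codefined_fun :: "((nat \<Rightarrow> nat) \<Rightarrow> nat) \<Rightarrow> ((nat \<Rightarrow> 'a) \<Rightarrow> 'a) \<Rightarrow> bool" where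
  "codefined_fun t t' \<longleftrightarrow>
     codefined (\<lambda>v. t (\<lambda>i. v (Suc i)) = v 0) (\<lambda>v. t' (\<lambda>i. v (Suc i)) = v 0)"

lemma codefined_fun_tm:
  assumes "\<And>v. eval_tm std_nat v t = f v" "\<And>v. eval_tm M v t = f' v"
  shows "codefined_fun f f'"
proof -
  have "\<exists>q. finitary q \<and>
    (\<forall>v. sat std_nat v q \<longleftrightarrow> eval_tm std_nat (\<lambda>i. v (Suc i)) t = v 0) \<and>
    (\<forall>v. sat M v q \<longleftrightarrow> eval_tm M (\<lambda>i. v (Suc i)) t = v 0)"
  proof -
    obtain t' where "\<And>v. eval_tm std_nat v t' = eval_tm std_nat (\<lambda>i. v (Suc i)) t"
      "\<And>v. eval_tm M v t' = eval_tm M (\<lambda>i. v (Suc i)) t"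
      using rename_tm[of Suc t] by blast
    then show ?thesis
      by (intro exI[of _ "Equal t' (Var 0)"]) simp
  qed
  then show ?thesis
    unfolding codefined_fun_def codefined_def by (simp add: assms)
qed

lemma codefined_fun_var: "codefined_fun (\<lambda>v. v i) (\<lambda>v. v i)"
  by (rule codefined_fun_tm[of "Var i"]) auto

lemma codefined_fun_lift:
  assumes "codefined_fun t t'"
  shows "codefined_fun (\<lambda>v. t (\<lambda>i. v (Suc i))) (\<lambda>v. t' (\<lambda>i. v (Suc i)))"
  using codefined_rename[OF assms[unfolded codefined_fun_def],
      of "\<lambda>i. case i of 0 \<Rightarrow> 0 | Suc j \<Rightarrow> Suc (Suc j)"]
  by (simp add: codefined_fun_def)

lemma codefined_rel3:
  assumes R: "codefined (\<lambda>v. R (v 0) (v 1) (v 2)) (\<lambda>v. R' (v 0) (v 1) (v 2))"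
    and s: "codefined_fun s s'" and t: "codefined_fun t t'" and u: "codefined_fun u u'"
  shows "codefined (\<lambda>v. R (s v) (t v) (u v)) (\<lambda>v. R' (s' v) (t' v) (u' v))"
proof -
  have "codefined (\<lambda>v. \<exists>x. s v = x \<and> (\<exists>y. t v = y \<and> (\<exists>z. u v = z \<and> R x y z)))
    (\<lambda>v. \<exists>x. s' v = x \<and> (\<exists>y. t' v = y \<and> (\<exists>z. u' v = z \<and> R' x y z)))"
  proof (intro codefined_ex codefined_conj)
    show "codefined (\<lambda>v. s (\<lambda>i. v (Suc i)) = v 0) (\<lambda>v. s' (\<lambda>i. v (Suc i)) = v 0)"
      using s by (simp add: codefined_fun_def)
    show "codefined (\<lambda>v. t (\<lambda>i. v (Suc (Suc i))) = v 0) (\<lambda>v. t' (\<lambda>i. v (Suc (Suc i))) = v 0)"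
      using codefined_fun_lift[OF t] by (simp add: codefined_fun_def)
    show "codefined (\<lambda>v. u (\<lambda>i. v (Suc (Suc (Suc i)))) = v 0)
        (\<lambda>v. u' (\<lambda>i. v (Suc (Suc (Suc i)))) = v 0)"
      using codefined_fun_lift[OF codefined_fun_lift[OF u]] by (simp add: codefined_fun_def)
    \<comment> \<open>The innermost quantifier owns slot 0, so \<open>x\<close>, \<open>y\<close>,
      \<open>z\<close> sit in slots 2, 1, 0; the renaming by \<open>2 - i\<close> reverses
      them.\<close>
    show "codefined (\<lambda>v. R (v (Suc (Suc 0))) (v (Suc 0)) (v 0))
        (\<lambda>v. R' (v (Suc (Suc 0))) (v (Suc 0)) (v 0))"
      using codefined_rename[OF R, of "\<lambda>i. 2 - i"] by (simp add: numeral_2_eq_2)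
  qed
  then show ?thesis
    by simp
qed

lemma codefined_rel2:
  assumes "codefined (\<lambda>v. R (v 0) (v 1)) (\<lambda>v. R' (v 0) (v 1))"
    "codefined_fun s s'" "codefined_fun t t'"
  shows "codefined (\<lambda>v. R (s v) (t v)) (\<lambda>v. R' (s' v) (t' v))"
  using codefined_rel3[of "\<lambda>x y _. R x y" "\<lambda>x y _. R' x y" s s' t t' t t'] assms by simp

lemma codefined_rel1:
  assumes "codefined (\<lambda>v. R (v 0)) (\<lambda>v. R' (v 0))" "codefined_fun s s'"
  shows "codefined (\<lambda>v. R (s v)) (\<lambda>v. R' (s' v))"
  using codefined_rel2[of "\<lambda>x _. R x" "\<lambda>x _. R' x" s s' s s'] assms by simp

lemma codefined_fun_comp2:
  assumes f: "codefined_fun (\<lambda>v. f (v 0) (v 1)) (\<lambda>v. f' (v 0) (v 1))"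
    and s: "codefined_fun s s'" and t: "codefined_fun t t'"
  shows "codefined_fun (\<lambda>v. f (s v) (t v)) (\<lambda>v. f' (s' v) (t' v))"
proof -
  have "codefined (\<lambda>v. f (v 0) (v 1) = v 2) (\<lambda>v. f' (v 0) (v 1) = v 2)"
    using codefined_rename[OF f[unfolded codefined_fun_def],
        of "\<lambda>i. if i = 0 then 2 else i - 1"] by simp
  from codefined_rel3[OF this codefined_fun_lift[OF s] codefined_fun_lift[OF t] codefined_fun_var[of 0]]
  show ?thesis
    by (simp add: codefined_fun_def)
qed

lemma codefined_eq:
  assumes "codefined_fun s s'" "codefined_fun t t'"
  shows "codefined (\<lambda>v. s v = t v) (\<lambda>v. s' v = t' v)"
proof (rule codefined_rel2[OF _ assms])
  show "codefined (\<lambda>v. v 0 = v 1) (\<lambda>v. v 0 = v 1)"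
    unfolding codefined_def by (intro exI[of _ "Equal (Var 0) (Var 1)"]) simp
qed

lemma codefined_less:
  assumes "codefined_fun s s'" "codefined_fun t t'"
  shows "codefined (\<lambda>v. s v < t v) (\<lambda>v. aless M (s' v) (t' v))"
proof (rule codefined_rel2[OF _ assms])
  show "codefined (\<lambda>v. v 0 < v 1) (\<lambda>v. aless M (v 0) (v 1))"
    unfolding codefined_def by (intro exI[of _ "Less (Var 0) (Var 1)"]) (simp add: std_nat_def)
qed

lemma codefined_zero: "codefined_fun (\<lambda>_. 0) (\<lambda>_. azero M)"
  by (rule codefined_fun_tm[of Zero]) (auto simp: std_nat_def)

lemma codefined_one: "codefined_fun (\<lambda>_. 1) (\<lambda>_. aone M)"
  by (rule codefined_fun_tm[of One]) (auto simp: std_nat_def)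

lemma codefined_plus:
  assumes "codefined_fun s s'" "codefined_fun t t'"
  shows "codefined_fun (\<lambda>v. s v + t v) (\<lambda>v. aplus M (s' v) (t' v))"
  by (rule codefined_fun_comp2[OF _ assms], rule codefined_fun_tm[of "Plus (Var 0) (Var 1)"])
    (auto simp: std_nat_def)

lemma codefined_times:
  assumes "codefined_fun s s'" "codefined_fun t t'"
  shows "codefined_fun (\<lambda>v. s v * t v) (\<lambda>v. atimes M (s' v) (t' v))"
  by (rule codefined_fun_comp2[OF _ assms], rule codefined_fun_tm[of "Times (Var 0) (Var 1)"])
    (auto simp: std_nat_def)

section \<open>The standard cut of the model\<close>

primrec std :: "nat \<Rightarrow> 'a" where
  "std 0 = azero M"
| "std (Suc n) = aplus M (std n) (aone M)"

lemma codefined_std: "codefined_fun (\<lambda>_. n) (\<lambda>_. std n)"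
proof (induction n)
  case 0
  show ?case
    using codefined_zero by simp
next
  case (Suc n)
  show ?case
    using codefined_plus[OF Suc codefined_one] by simp
qed

lemmas codefined_intros = codefined_ex codefined_all codefined_not codefined_conj codefined_disj
  codefined_imp codefined_iff codefined_eq codefined_less codefined_plus codefined_times
  codefined_zero codefined_one codefined_fun_var codefined_std

lemma std_inject: "std m = std n \<longleftrightarrow> m = n"
proof -
  have "m = n \<longleftrightarrow> std m = std n"
    by (rule transfer) (intro codefined_intros)
  then show ?thesis ..
qed

lemma std_plus: "std (m + n) = aplus M (std m) (std n)"
proof -
  have "m + n = m + n \<longleftrightarrow> aplus M (std m) (std n) = std (m + n)"
    by (rule transfer, rule codefined_eq, rule codefined_plus) (rule codefined_std)+
  then show ?thesis by simp
qed

lemma std_times: "std (m * n) = atimes M (std m) (std n)"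
proof -
  have "m * n = m * n \<longleftrightarrow> atimes M (std m) (std n) = std (m * n)"
    by (rule transfer, rule codefined_eq, rule codefined_times) (rule codefined_std)+
  then show ?thesis by simp
qed

lemma std_less: "aless M (std m) (std n) \<longleftrightarrow> m < n"
proof -
  have "m < n \<longleftrightarrow> aless M (std m) (std n)"
    by (rule transfer) (intro codefined_intros)
  then show ?thesis ..
qed

lemma less_linear: "aless M x y \<or> x = y \<or> aless M y x"
proof -
  have "(\<forall>x y. x < y \<or> x = y \<or> y < (x :: nat)) \<longleftrightarrow> (\<forall>x y. aless M x y \<or> x = y \<or> aless M y x)"
    by (rule transfer) (intro codefined_intros)
  moreover have "\<forall>x y. x < y \<or> x = y \<or> y < (x :: nat)"
    by auto
  ultimately show ?thesis by blast
qed

text \<open>The standard part is an initial segment. The induction on \<open>n\<close> takes place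
  outside \<open>M\<close>; only the order facts about zero and successor are transferred.\<close>

lemma less_std_imp_std:
  assumes "aless M x (std n)"
  shows "x \<in> std ` {..<n}"
  using assms
proof (induction n)
  case 0
  have "(\<forall>x. \<not> x < (0 :: nat)) \<longleftrightarrow> (\<forall>x. \<not> aless M x (azero M))"
    by (rule transfer) (intro codefined_intros)
  then show ?case
    using 0 by simp
next
  case (Suc n)
  have "(\<forall>x y. x < y + 1 \<longrightarrow> x < y \<or> x = (y :: nat)) \<longleftrightarrow>
      (\<forall>x y. aless M x (aplus M y (aone M)) \<longrightarrow> aless M x y \<or> x = y)"
    by (rule transfer) (intro codefined_intros)
  moreover have "\<forall>x y. x < y + 1 \<longrightarrow> x < y \<or> x = (y :: nat)"
    by auto
  ultimately have "aless M x (std n) \<or> x = std n"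
    using Suc.prems by simp
  then show ?case
    using Suc.IH by auto
qed

lemma std_less_nonstandard: "a \<notin> range std \<Longrightarrow> aless M (std n) a"
  using less_linear[of "std n" a] less_std_imp_std[of a n] by auto

text \<open>\<open>std\<close> is injective and respects all symbols, so surjectivity is the only
  way in which it can fail to be an isomorphism.\<close>

lemma ex_nonstandard:
  assumes "nonstandard M"
  obtains a where "a \<notin> range std"
proof -
  have "\<not> isomorphism std_nat M std"
    using assms by (auto simp: nonstandard_def)
  moreover have "std 1 = aone M"
  proof -
    have "1 = (1 :: nat) \<longleftrightarrow> aone M = std 1"
      by (rule transfer, rule codefined_eq, rule codefined_one, rule codefined_std)
    then show ?thesis by simp
  qed
  ultimately have "\<not> surj std"
    using std_inject std_plus std_times std_less
    by (auto simp: isomorphism_def std_nat_def bij_def inj_def)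
  then show ?thesis
    using that by blast
qed

text \<open>The extension stays anonymous, which suits relations built in several layers such as
  \<open>holds n\<close> or \<open>best_match\<close>; the extension lemmas below recover it with
  the right arity.\<close>

definition arithmetical :: "((nat \<Rightarrow> nat) \<Rightarrow> bool) \<Rightarrow> bool" where
  "arithmetical P \<longleftrightarrow> (\<exists>P'. codefined P P')"

definition arithmetical_fun :: "((nat \<Rightarrow> nat) \<Rightarrow> nat) \<Rightarrow> bool" where
  "arithmetical_fun t \<longleftrightarrow> (\<exists>t'. codefined_fun t t')"

lemma arithmetical_not: "arithmetical P \<Longrightarrow> arithmetical (\<lambda>v. \<not> P v)"
  unfolding arithmetical_def using codefined_not by blast

lemma arithmetical_conj: "arithmetical P \<Longrightarrow> arithmetical Q \<Longrightarrow> arithmetical (\<lambda>v. P v \<and> Q v)"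
  unfolding arithmetical_def using codefined_conj by blast

lemma arithmetical_disj: "arithmetical P \<Longrightarrow> arithmetical Q \<Longrightarrow> arithmetical (\<lambda>v. P v \<or> Q v)"
  unfolding arithmetical_def using codefined_disj by blast

lemma arithmetical_imp: "arithmetical P \<Longrightarrow> arithmetical Q \<Longrightarrow> arithmetical (\<lambda>v. P v \<longrightarrow> Q v)"
  unfolding arithmetical_def using codefined_imp by blast

lemma arithmetical_iff: "arithmetical P \<Longrightarrow> arithmetical Q \<Longrightarrow> arithmetical (\<lambda>v. P v \<longleftrightarrow> Q v)"
  unfolding arithmetical_def using codefined_iff by blast

lemma arithmetical_ex:
  assumes "arithmetical (\<lambda>v. P (\<lambda>i. v (Suc i)) (v 0))"
  shows "arithmetical (\<lambda>v. \<exists>x. P v x)"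
proof -
  obtain Q where "codefined (\<lambda>v. P (\<lambda>i. v (Suc i)) (v 0)) Q"
    using assms by (auto simp: arithmetical_def)
  moreover have "case_nat (v 0) (\<lambda>i. v (Suc i)) = v" for v :: "nat \<Rightarrow> 'a"
    by (auto split: nat.split)
  ultimately have "codefined (\<lambda>v. P (\<lambda>i. v (Suc i)) (v 0))
      (\<lambda>v. Q (case_nat (v 0) (\<lambda>i. v (Suc i))))"
    by simp
  then have "codefined (\<lambda>v. \<exists>x. P v x) (\<lambda>v. \<exists>x. Q (case_nat x v))"
    by (rule codefined_ex)
  then show ?thesis
    by (auto simp: arithmetical_def)
qed

lemma arithmetical_all:
  assumes "arithmetical (\<lambda>v. P (\<lambda>i. v (Suc i)) (v 0))"
  shows "arithmetical (\<lambda>v. \<forall>x. P v x)"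
  using arithmetical_not[OF arithmetical_ex, of "\<lambda>v x. \<not> P v x"] arithmetical_not[OF assms]
  by simp

lemma arithmetical_eq:
  "arithmetical_fun s \<Longrightarrow> arithmetical_fun t \<Longrightarrow> arithmetical (\<lambda>v. s v = t v)"
  unfolding arithmetical_def arithmetical_fun_def using codefined_eq by blast

lemma arithmetical_less:
  "arithmetical_fun s \<Longrightarrow> arithmetical_fun t \<Longrightarrow> arithmetical (\<lambda>v. s v < t v)"
  unfolding arithmetical_def arithmetical_fun_def using codefined_less by blast

lemma arithmetical_plus:
  "arithmetical_fun s \<Longrightarrow> arithmetical_fun t \<Longrightarrow> arithmetical_fun (\<lambda>v. s v + t v)"
  unfolding arithmetical_fun_def using codefined_plus by blast

lemma arithmetical_times:
  "arithmetical_fun s \<Longrightarrow> arithmetical_fun t \<Longrightarrow> arithmetical_fun (\<lambda>v. s v * t v)"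
  unfolding arithmetical_fun_def using codefined_times by blast

lemma arithmetical_const: "arithmetical_fun (\<lambda>_. n)"
  unfolding arithmetical_fun_def using codefined_std by blast

lemma arithmetical_var: "arithmetical_fun (\<lambda>v. v i)"
  unfolding arithmetical_fun_def using codefined_fun_var by blast

text \<open>The defining formula may mention further variables, on which the extension could a
  priori depend; they are all identified with slot 2.\<close>

lemma arithmetical_extension3:
  assumes "arithmetical (\<lambda>v. R (v 0) (v 1) (v 2))"
  obtains R' where "codefined (\<lambda>v. R (v 0) (v 1) (v 2)) (\<lambda>v. R' (v 0) (v 1) (v 2))"
proof -
  obtain Q where "codefined (\<lambda>v. R (v 0) (v 1) (v 2)) Q"
    using assms by (auto simp: arithmetical_def)
  from codefined_rename[OF this, of "\<lambda>i. if i = 0 then 0 else if i = 1 then 1 else 2"]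
  have *: "codefined (\<lambda>v. R (v 0) (v 1) (v 2))
      (\<lambda>v. Q (\<lambda>i. v (if i = 0 then 0 else if i = 1 then 1 else 2)))"
    by simp
  have "(\<lambda>i. v (if i = 0 then 0 else if i = 1 then 1 else 2)) =
      (\<lambda>i. if i = 0 then v 0 else if i = 1 then v 1 else v 2)" for v :: "nat \<Rightarrow> 'a"
    by auto
  from *[unfolded this] show ?thesis
    by (rule that)
qed

lemma arithmetical_extension2:
  assumes "arithmetical (\<lambda>v. R (v 0) (v 1))"
  obtains R' where "codefined (\<lambda>v. R (v 0) (v 1)) (\<lambda>v. R' (v 0) (v 1))"
proof -
  obtain R' where "codefined (\<lambda>v. R (v 0) (v 1)) (\<lambda>v. R' (v 0) (v 1) (v 2))"
    by (rule arithmetical_extension3[of "\<lambda>x y _. R x y", OF assms])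
  from codefined_rename[OF this, of "\<lambda>i. if i = 0 then 0 else 1"] show ?thesis
    using that[of "\<lambda>x y. R' x y y"] by simp
qed

lemma arithmetical_extension1:
  assumes "arithmetical (\<lambda>v. R (v 0))"
  obtains R' where "codefined (\<lambda>v. R (v 0)) (\<lambda>v. R' (v 0))"
proof -
  obtain R' where "codefined (\<lambda>v. R (v 0)) (\<lambda>v. R' (v 0) (v 1))"
    by (rule arithmetical_extension2[of "\<lambda>x _. R x", OF assms])
  from codefined_rename[OF this, of "\<lambda>i. 0"] show ?thesis
    using that[of "\<lambda>x. R' x x"] by simp
qed

lemma arithmetical_rel2:
  assumes "arithmetical (\<lambda>v. R (v 0) (v 1))" "arithmetical_fun s" "arithmetical_fun t"
  shows "arithmetical (\<lambda>v. R (s v) (t v))"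
proof -
  obtain R' where "codefined (\<lambda>v. R (v 0) (v 1)) (\<lambda>v. R' (v 0) (v 1))"
    by (rule arithmetical_extension2[OF assms(1)])
  moreover obtain s' t' where "codefined_fun s s'" "codefined_fun t t'"
    using assms(2,3) by (auto simp: arithmetical_fun_def)
  ultimately show ?thesis
    unfolding arithmetical_def using codefined_rel2[of R R' s s' t t'] by blast
qed

text \<open>Totality and uniqueness of the value are first-order properties of the graph, so they
  transfer and the extended graph is again that of a function.\<close>

lemma codefined_fun2_if_arithmetical:
  assumes "arithmetical (\<lambda>v. f (v 0) (v 1) = v 2)"
  obtains f' where "codefined_fun (\<lambda>v. f (v 0) (v 1)) (\<lambda>v. f' (v 0) (v 1))"
proof -
  obtain R where R: "codefined (\<lambda>v. f (v 0) (v 1) = v 2) (\<lambda>v. R (v 0) (v 1) (v 2))"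
    by (rule arithmetical_extension3[of "\<lambda>x y z. f x y = z", OF assms])
  have "(\<forall>x y. \<exists>z. f x y = z \<and> (\<forall>w. f x y = w \<longrightarrow> w = z)) \<longleftrightarrow>
      (\<forall>x y. \<exists>z. R x y z \<and> (\<forall>w. R x y w \<longrightarrow> w = z))"
    by (rule transfer) (intro codefined_rel3[OF R] codefined_intros(1-8) codefined_fun_var)
  then have unique: "\<exists>!z. R x y z" for x y
    by blast
  define f' where "f' x y = (THE z. R x y z)" for x y
  have f': "f' x y = z \<longleftrightarrow> R x y z" for x y z
    unfolding f'_def using theI'[OF unique[of x y]] the1_equality[OF unique[of x y], of z] by auto
  from codefined_rename[OF R, of "\<lambda>i. if i = 2 then 0 else Suc i"]
  have "codefined_fun (\<lambda>v. f (v 0) (v 1)) (\<lambda>v. f' (v 0) (v 1))"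
    by (simp add: codefined_fun_def f')
  then show ?thesis
    using that by blast
qed

lemma arithmetical_fun_comp2:
  assumes "arithmetical (\<lambda>v. f (v 0) (v 1) = v 2)" "arithmetical_fun s" "arithmetical_fun t"
  shows "arithmetical_fun (\<lambda>v. f (s v) (t v))"
proof -
  obtain f' where "codefined_fun (\<lambda>v. f (v 0) (v 1)) (\<lambda>v. f' (v 0) (v 1))"
    by (rule codefined_fun2_if_arithmetical[OF assms(1)])
  moreover obtain s' t' where "codefined_fun s s'" "codefined_fun t t'"
    using assms(2,3) by (auto simp: arithmetical_fun_def)
  ultimately show ?thesis
    unfolding arithmetical_fun_def using codefined_fun_comp2[of f f' s s' t t'] by blast
qed

lemmas arithmetical_intros = arithmetical_ex arithmetical_all arithmetical_not arithmetical_conj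
  arithmetical_disj arithmetical_imp arithmetical_iff arithmetical_eq arithmetical_less
  arithmetical_plus arithmetical_times arithmetical_const arithmetical_var

end

section \<open>Coding finite sets, tuples and types\<close>

text \<open>A pairing that is a term of the language, with no division by 2 as in Cantor's. It is
  injective because adding \<open>x\<close> to the square of \<open>x + y\<close> stays below the
  next square.\<close>

definition pair :: "nat \<Rightarrow> nat \<Rightarrow> nat" where
  "pair x y = (x + y) * (x + y) + x"

lemma pair_inject: "pair x y = pair x' y' \<longleftrightarrow> x = x' \<and> y = y'"
proof
  have less: "pair a b < pair c d" if "a + b < c + d" for a b c d
  proof -
    have "pair a b < (a + b + 1) * (a + b + 1)"
      by (simp add: pair_def)
    also have "\<dots> \<le> (c + d) * (c + d)"
      using that by (intro mult_le_mono) auto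
    finally show ?thesis
      by (simp add: pair_def)
  qed
  assume *: "pair x y = pair x' y'"
  then have "x + y = x' + y'"
    using less[of x y x' y'] less[of x' y' x y] by (metis less_irrefl nat_neq_iff)
  then show "x = x' \<and> y = y'"
    using * by (simp add: pair_def)
qed auto

lemma le_pair: "x \<le> pair x y \<and> y \<le> pair x y"
  using le_square[of "x + y"] unfolding pair_def by linarith

text \<open>A positive tag makes the descent to subterm codes strict.\<close>

lemma less_pair: "0 < x \<Longrightarrow> y < pair x y"
  using le_square[of "x + y"] unfolding pair_def by linarith

lemma pair_strict_mono: "y < z \<Longrightarrow> pair x y < pair x z"
  unfolding pair_def by (simp add: mult_strict_mono)

text \<open>With \<open>s = pair u (k!)\<close>, the numbers \<open>(i + 1) * k! + 1\<close> for \<open>i < k\<close> are pairwise coprime, so their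
  divisibility into \<open>u\<close> can be prescribed independently.\<close>

definition elem :: "nat \<Rightarrow> nat \<Rightarrow> bool" where
  "elem i s \<longleftrightarrow> (\<exists>u b q. s = pair u b \<and> u = q * ((i + 1) * b + 1))"

lemma ex_elem: "\<exists>s. \<forall>i<k. elem i s \<longleftrightarrow> P i"
proof -
  define b :: nat where "b = fact k"
  define m where "m i = (i + 1) * b + 1" for i
  define u where "u = (\<Prod>j \<in> {j. j < k \<and> P j}. m j)"
  have cop_b: "coprime (m i) b" for i
  proof (rule coprimeI)
    fix d assume "d dvd m i" "d dvd b"
    then show "is_unit d"
      unfolding m_def by (metis dvd_add_right_iff dvd_mult)
  qed
  \<comment> \<open>A common divisor divides the difference \<open>(j - i) * b\<close>. Being
    coprime to \<open>b\<close> it divides \<open>j - i\<close>, which in turn divides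
    \<open>k!\<close>; so it is a unit.\<close>
  have cop_lt: "coprime (m i) (m j)" if "i < j" "j < k" for i j
  proof (rule coprimeI)
    fix d assume d: "d dvd m i" "d dvd m j"
    have "m j = m i + (j - i) * b"
      using that by (simp add: m_def algebra_simps diff_mult_distrib)
    then have "d dvd (j - i) * b"
      using d by (simp add: dvd_add_right_iff)
    moreover have "coprime d b"
      using cop_b d(1) coprime_divisors dvd_refl by blast
    ultimately have "d dvd j - i"
      by (simp add: coprime_dvd_mult_left_iff)
    moreover have "j - i dvd b"
      unfolding b_def using that by (intro dvd_fact) auto
    ultimately have "d dvd b"
      using dvd_trans by blast
    then show "is_unit d"
      using coprime_common_divisor[OF \<open>coprime d b\<close> dvd_refl] by blast
  qed
  have cop: "coprime (m i) (m j)" if "i \<noteq> j" "i < k" "j < k" for i j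
    using that cop_lt[of i j] cop_lt[of j i] by (auto simp: coprime_commute nat_neq_iff)
  have "m i dvd u \<longleftrightarrow> P i" if i: "i < k" for i
  proof
    assume "P i"
    then show "m i dvd u"
      unfolding u_def using i by (intro dvd_prodI) auto
  next
    assume dvd: "m i dvd u"
    show "P i"
    proof (rule ccontr)
      assume "\<not> P i"
      then have "coprime (m i) u"
        unfolding u_def using i by (intro prod_coprime_right cop) auto
      then have "m i = 1"
        using coprime_common_divisor[of "m i" u "m i"] dvd by simp
      then show False
        by (simp add: m_def b_def)
    qed
  qed
  then have "\<forall>i<k. elem i (pair u b) \<longleftrightarrow> P i"
    by (auto simp: elem_def pair_inject m_def dvd_def mult.commute)
  then show ?thesis ..
qed

text \<open>A tuple is coded by the set of its pairs (index, value). \<open>ex_elem\<close> controls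
  a set only below a bound, so \<open>LEAST\<close> selects among stray pairs and the default 0
  makes every number a code.\<close>

definition entry :: "nat \<Rightarrow> nat \<Rightarrow> nat" where
  "entry x i = (if \<exists>v. elem (pair i v) x then LEAST v. elem (pair i v) x else 0)"

lemma ex_entry: "\<exists>x. \<forall>i<k. entry x i = f i"
proof -
  \<comment> \<open>\<open>K\<close> exceeds every \<open>pair i (f i)\<close>, and with it the
    pairs \<open>pair i v\<close> for \<open>v < f i\<close> that \<open>LEAST\<close> has to
    skip.\<close>
  define K where "K = Suc (\<Sum>i<k. pair i (f i))"
  obtain x where x: "\<And>j. j < K \<Longrightarrow> elem j x \<longleftrightarrow> (\<exists>i<k. j = pair i (f i))"
    using ex_elem[of K "\<lambda>j. \<exists>i<k. j = pair i (f i)"] by blast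
  have "entry x i = f i" if i: "i < k" for i
  proof -
    have "pair i (f i) \<le> (\<Sum>i<k. pair i (f i))"
      using i by (intro member_le_sum) auto
    then have K: "pair i (f i) < K"
      by (simp add: K_def)
    have el: "elem (pair i (f i)) x"
      using x[OF K] i by blast
    moreover have "f i \<le> v" if "elem (pair i v) x" for v
    proof (rule ccontr)
      assume "\<not> f i \<le> v"
      then have "pair i v < pair i (f i)"
        by (intro pair_strict_mono) simp
      then have "\<exists>i'<k. pair i v = pair i' (f i')"
        using x[of "pair i v"] K that by simp
      then show False
        using \<open>\<not> f i \<le> v\<close> by (auto simp: pair_inject)
    qed
    ultimately have "(LEAST v. elem (pair i v) x) = f i"
      by (intro Least_equality) auto
    then show ?thesis
      using el by (auto simp: entry_def)
  qed
  then show ?thesis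
    by blast
qed

text \<open>This eliminates \<open>LEAST\<close> from the graph, so that the closure rules for
  arithmetical relations apply.\<close>

lemma entry_eq_iff:
  "entry x i = z \<longleftrightarrow> (elem (pair i z) x \<and> (\<forall>w. w < z \<longrightarrow> \<not> elem (pair i w) x)) \<or>
    (z = 0 \<and> (\<forall>w. \<not> elem (pair i w) x))"
proof (cases "\<exists>v. elem (pair i v) x")
  case True
  then have "entry x i = (LEAST v. elem (pair i v) x)"
    by (simp add: entry_def)
  then have least: "elem (pair i (entry x i)) x" "w < entry x i \<Longrightarrow> \<not> elem (pair i w) x" for w
    using LeastI_ex[OF True] not_less_Least[of w "\<lambda>v. elem (pair i v) x"] by simp_all
  show ?thesis (is "_ \<longleftrightarrow> ?r")
  proof
    assume "entry x i = z"
    then show ?r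
      using least by auto
  next
    assume ?r
    then have "elem (pair i z) x" "\<And>w. w < z \<Longrightarrow> \<not> elem (pair i w) x"
      using True by auto
    then have "\<not> entry x i < z" "\<not> z < entry x i"
      using least by auto
    then show "entry x i = z"
      by simp
  qed
next
  case False
  then show ?thesis
    by (auto simp: entry_def)
qed

section \<open>Evaluation of coded terms and finite pieces of types\<close>

primrec code_tm :: "tm \<Rightarrow> nat" where
  "code_tm (Var j) = pair 0 (pair j 0)"
| "code_tm Zero = pair 1 (pair 0 0)"
| "code_tm One = pair 2 (pair 0 0)"
| "code_tm (Plus s t) = pair 3 (pair (code_tm s) (code_tm t))"
| "code_tm (Times s t) = pair 4 (pair (code_tm s) (code_tm t))"

text \<open>A recursion becomes first-order by asking for a table \<open>w\<close> that obeys it: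
  entry \<open>e\<close> of \<open>w\<close> is the value of the term with code \<open>e\<close>
  under the tuple \<open>x\<close>.\<close>

definition evaluates :: "nat \<Rightarrow> nat \<Rightarrow> nat \<Rightarrow> bool" where
  "evaluates w x k \<longleftrightarrow> (\<forall>c a b. pair c (pair a b) < k \<longrightarrow>
     (c = 0 \<longrightarrow> entry w (pair c (pair a b)) = entry x a) \<and>
     (c = 1 \<longrightarrow> entry w (pair c (pair a b)) = 0) \<and>
     (c = 2 \<longrightarrow> entry w (pair c (pair a b)) = 1) \<and>
     (c = 3 \<longrightarrow> entry w (pair c (pair a b)) = entry w a + entry w b) \<and>
     (c = 4 \<longrightarrow> entry w (pair c (pair a b)) = entry w a * entry w b))"

lemma subterm_code_less: "0 < c \<Longrightarrow> a < pair c (pair a b) \<and> b < pair c (pair a b)"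
  using le_pair[of a b] less_pair[of c "pair a b"] by linarith

lemma evaluates_code_tm:
  assumes "evaluates w x k" "code_tm t < k"
  shows "entry w (code_tm t) = eval_tm std_nat (entry x) t"
  using assms(2)
proof (induction t)
  case (Plus s t)
  moreover have "code_tm s < k" "code_tm t < k"
    using Plus.prems subterm_code_less[of 3 "code_tm s" "code_tm t"] by auto
  ultimately show ?case
    using assms(1) by (simp add: evaluates_def std_nat_def)
next
  case (Times s t)
  moreover have "code_tm s < k" "code_tm t < k"
    using Times.prems subterm_code_less[of 4 "code_tm s" "code_tm t"] by auto
  ultimately show ?case
    using assms(1) by (simp add: evaluates_def std_nat_def)
qed (use assms(1) in \<open>auto simp: evaluates_def std_nat_def\<close>)

lemma ex_evaluates: "\<exists>w. evaluates w x k"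
proof (induction k)
  case 0
  show ?case
    by (simp add: evaluates_def)
next
  case (Suc k)
  then obtain w where w: "evaluates w x k"
    by blast
  have "\<exists>d. \<forall>c a b. pair c (pair a b) = k \<longrightarrow> (c = 0 \<longrightarrow> d = entry x a) \<and> (c = 1 \<longrightarrow> d = 0) \<and>
     (c = 2 \<longrightarrow> d = 1) \<and> (c = 3 \<longrightarrow> d = entry w a + entry w b) \<and> (c = 4 \<longrightarrow> d = entry w a * entry w b)"
  proof (cases "\<exists>c a b. pair c (pair a b) = k")
    case True
    then obtain c a b where k: "k = pair c (pair a b)"
      by blast
    show ?thesis
      unfolding k pair_inject
      by (rule exI[of _ "if c = 0 then entry x a else if c = 1 then 0 else if c = 2 then 1
        else if c = 3 then entry w a + entry w b else entry w a * entry w b"]) auto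
  qed auto
  then obtain d where d: "\<And>c a b. pair c (pair a b) = k \<Longrightarrow> (c = 0 \<longrightarrow> d = entry x a) \<and>
     (c = 1 \<longrightarrow> d = 0) \<and> (c = 2 \<longrightarrow> d = 1) \<and> (c = 3 \<longrightarrow> d = entry w a + entry w b) \<and>
     (c = 4 \<longrightarrow> d = entry w a * entry w b)"
    by blast
  obtain w' where "\<forall>i<Suc k. entry w' i = (if i = k then d else entry w i)"
    using ex_entry[of "Suc k" "\<lambda>i. if i = k then d else entry w i"] by blast
  then have w': "entry w' k = d" "\<And>i. i < k \<Longrightarrow> entry w' i = entry w i"
    by auto
  have "evaluates w' x (Suc k)"
    unfolding evaluates_def
  proof (intro allI)
    fix c a b
    define e where "e = pair c (pair a b)"
    \<comment> \<open>Subcodes lie below \<open>e\<close> only for a positive tag; the clause for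
      tag 0 consults \<open>x\<close> and not the table.\<close>
    have sub: "0 < c \<Longrightarrow> a < e" "0 < c \<Longrightarrow> b < e"
      unfolding e_def using subterm_code_less by blast+
    consider "e = k" | "e < k" | "e > k"
      by linarith
    then have "e < Suc k \<longrightarrow> (c = 0 \<longrightarrow> entry w' e = entry x a) \<and>
      (c = 1 \<longrightarrow> entry w' e = 0) \<and> (c = 2 \<longrightarrow> entry w' e = 1) \<and>
      (c = 3 \<longrightarrow> entry w' e = entry w' a + entry w' b) \<and>
      (c = 4 \<longrightarrow> entry w' e = entry w' a * entry w' b)"
    proof cases
      case 1
      then show ?thesis
        using d[of c a b, folded e_def, OF 1] sub w' by auto
    next
      case 2
      then show ?thesis
        using w[unfolded evaluates_def, rule_format, of c a b, folded e_def] sub w' by auto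
    qed auto
    then show "pair c (pair a b) < Suc k \<longrightarrow>
      (c = 0 \<longrightarrow> entry w' (pair c (pair a b)) = entry x a) \<and>
      (c = 1 \<longrightarrow> entry w' (pair c (pair a b)) = 0) \<and>
      (c = 2 \<longrightarrow> entry w' (pair c (pair a b)) = 1) \<and>
      (c = 3 \<longrightarrow> entry w' (pair c (pair a b)) = entry w' a + entry w' b) \<and>
      (c = 4 \<longrightarrow> entry w' (pair c (pair a b)) = entry w' a * entry w' b)"
      by (simp add: e_def)
  qed
  then show ?case ..
qed

text \<open>\<open>holds 0\<close> is truth of coded atomic formulas. An index of \<open>holds (Suc n)\<close> prescribes finitely many
  entries to be kept and a finite piece of a \<open>holds n\<close>-type to be realised, so that equality of
  \<open>holds\<close>-types is a back-and-forth relation. No other formulas have to be coded.\<close>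

primrec holds :: "nat \<Rightarrow> nat \<Rightarrow> nat \<Rightarrow> bool" where
  "holds 0 i x \<longleftrightarrow> (\<exists>w c a b. evaluates w x i \<and> i = pair c (pair a b) \<and>
     (c = 1 \<and> entry w a = entry w b \<or> c = 2 \<and> entry w a < entry w b))"
| "holds (Suc n) s x \<longleftrightarrow> (\<exists>l z k t y. s = pair l (pair z (pair k t)) \<and>
     (\<forall>j. j < l \<longrightarrow> elem j z \<longrightarrow> entry y j = entry x j) \<and>
     (\<forall>i. i < k \<longrightarrow> (elem i t \<longleftrightarrow> holds n i y)))"

lemma holds_0_Equal:
  "holds 0 (pair 1 (pair (code_tm s) (code_tm t))) x \<longleftrightarrow>
    eval_tm std_nat (entry x) s = eval_tm std_nat (entry x) t"
  using ex_evaluates[of x "pair 1 (pair (code_tm s) (code_tm t))"]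
    evaluates_code_tm[of _ x "pair 1 (pair (code_tm s) (code_tm t))" s]
    evaluates_code_tm[of _ x "pair 1 (pair (code_tm s) (code_tm t))" t]
    subterm_code_less[of 1 "code_tm s" "code_tm t"]
  by (auto simp: pair_inject)

lemma holds_0_Less:
  "holds 0 (pair 2 (pair (code_tm s) (code_tm t))) x \<longleftrightarrow>
    eval_tm std_nat (entry x) s < eval_tm std_nat (entry x) t"
  using ex_evaluates[of x "pair 2 (pair (code_tm s) (code_tm t))"]
    evaluates_code_tm[of _ x "pair 2 (pair (code_tm s) (code_tm t))" s]
    evaluates_code_tm[of _ x "pair 2 (pair (code_tm s) (code_tm t))" t]
    subterm_code_less[of 2 "code_tm s" "code_tm t"]
  by (auto simp: pair_inject)

context true_arith_model
begin

lemma arithmetical_pair: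
  "arithmetical_fun s \<Longrightarrow> arithmetical_fun t \<Longrightarrow> arithmetical_fun (\<lambda>v. pair (s v) (t v))"
  unfolding pair_def by (intro arithmetical_plus arithmetical_times)

lemma arithmetical_elem:
  "arithmetical_fun s \<Longrightarrow> arithmetical_fun t \<Longrightarrow> arithmetical (\<lambda>v. elem (s v) (t v))"
  by (rule arithmetical_rel2[of elem]) (unfold elem_def, (intro arithmetical_pair arithmetical_intros)?)

lemma arithmetical_entry:
  "arithmetical_fun s \<Longrightarrow> arithmetical_fun t \<Longrightarrow> arithmetical_fun (\<lambda>v. entry (s v) (t v))"
  by (rule arithmetical_fun_comp2[of entry])
    (unfold entry_eq_iff, (intro arithmetical_pair arithmetical_elem arithmetical_intros)?)

text \<open>The index \<open>n\<close> is external: each \<open>holds n\<close> gets its own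
  formula, with more quantifiers as \<open>n\<close> grows.\<close>

lemma arithmetical_holds:
  "arithmetical_fun s \<Longrightarrow> arithmetical_fun t \<Longrightarrow> arithmetical (\<lambda>v. holds n (s v) (t v))"
proof (rule arithmetical_rel2[of "holds n"])
  show "arithmetical (\<lambda>v. holds n (v 0) (v 1))"
  proof (induction n)
    case 0
    show ?case
      unfolding holds.simps evaluates_def
      by (intro arithmetical_pair arithmetical_entry arithmetical_intros)
  next
    case (Suc n)
    note IH = arithmetical_rel2[of "holds n", OF Suc]
    show ?case
      unfolding holds.simps
      by (intro IH arithmetical_pair arithmetical_entry arithmetical_elem arithmetical_intros)
  qed
qed

end

section \<open>Back-and-forth in a nonstandard model\<close>

context true_arith_model
begin

section \<open>Extensions of the coding relations to the model\<close>

definition elem' :: "'a \<Rightarrow> 'a \<Rightarrow> bool" where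
  "elem' = (SOME R'. codefined (\<lambda>v. elem (v 0) (v 1)) (\<lambda>v. R' (v 0) (v 1)))"

definition entry' :: "'a \<Rightarrow> 'a \<Rightarrow> 'a" where
  "entry' = (SOME f'. codefined_fun (\<lambda>v. entry (v 0) (v 1)) (\<lambda>v. f' (v 0) (v 1)))"

definition holds' :: "nat \<Rightarrow> 'a \<Rightarrow> 'a \<Rightarrow> bool" where
  "holds' n = (SOME R'. codefined (\<lambda>v. holds n (v 0) (v 1)) (\<lambda>v. R' (v 0) (v 1)))"

lemma codefined_elem:
  assumes "codefined_fun s s'" "codefined_fun t t'"
  shows "codefined (\<lambda>v. elem (s v) (t v)) (\<lambda>v. elem' (s' v) (t' v))"
proof -
  have "arithmetical (\<lambda>v. elem (v 0) (v 1))"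
    by (intro arithmetical_elem arithmetical_var)
  then have "\<exists>R'. codefined (\<lambda>v. elem (v 0) (v 1)) (\<lambda>v. R' (v 0) (v 1))"
    by (rule arithmetical_extension2) blast
  then have "codefined (\<lambda>v. elem (v 0) (v 1)) (\<lambda>v. elem' (v 0) (v 1))"
    unfolding elem'_def by (rule someI_ex)
  then show ?thesis
    using assms by (rule codefined_rel2)
qed

lemma codefined_holds:
  assumes "codefined_fun s s'" "codefined_fun t t'"
  shows "codefined (\<lambda>v. holds n (s v) (t v)) (\<lambda>v. holds' n (s' v) (t' v))"
proof -
  have "arithmetical (\<lambda>v. holds n (v 0) (v 1))"
    by (intro arithmetical_holds arithmetical_var)
  then have "\<exists>R'. codefined (\<lambda>v. holds n (v 0) (v 1)) (\<lambda>v. R' (v 0) (v 1))"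
    by (rule arithmetical_extension2) blast
  then have "codefined (\<lambda>v. holds n (v 0) (v 1)) (\<lambda>v. holds' n (v 0) (v 1))"
    unfolding holds'_def by (rule someI_ex)
  then show ?thesis
    using assms by (rule codefined_rel2)
qed

lemma codefined_entry:
  assumes "codefined_fun s s'" "codefined_fun t t'"
  shows "codefined_fun (\<lambda>v. entry (s v) (t v)) (\<lambda>v. entry' (s' v) (t' v))"
proof -
  have "arithmetical (\<lambda>v. entry (v 0) (v 1) = v 2)"
    by (intro arithmetical_eq arithmetical_entry arithmetical_var)
  then have "\<exists>f'. codefined_fun (\<lambda>v. entry (v 0) (v 1)) (\<lambda>v. f' (v 0) (v 1))"
    by (rule codefined_fun2_if_arithmetical) blast
  then have "codefined_fun (\<lambda>v. entry (v 0) (v 1)) (\<lambda>v. entry' (v 0) (v 1))"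
    unfolding entry'_def by (rule someI_ex)
  then show ?thesis
    using assms by (rule codefined_fun_comp2)
qed

lemma elem'_std: "elem' (std i) (std s) \<longleftrightarrow> elem i s"
proof -
  have "elem i s \<longleftrightarrow> elem' (std i) (std s)"
    by (rule transfer) (intro codefined_elem codefined_std)
  then show ?thesis ..
qed

text \<open>Every element of \<open>M\<close> codes a tuple, of which only the entries with standard index are
  used as an environment.\<close>

definition env :: "'a \<Rightarrow> nat \<Rightarrow> 'a" where
  "env x = (\<lambda>j. entry' x (std j))"

text \<open>Changing one entry of a code is possible by transfer, even to a nonstandard value. As
  \<open>l\<close> is standard, this can be iterated outside \<open>M\<close>.\<close>

lemma ex_env: "\<exists>x. \<forall>j<l. env x j = v j"
proof (induction l)
  case (Suc l)
  then obtain x where x: "\<And>j. j < l \<Longrightarrow> env x j = v j"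
    by blast
  have "(\<forall>x k a. \<exists>y. entry y k = a \<and> (\<forall>j. j < k \<longrightarrow> entry y j = entry x j)) \<longleftrightarrow>
    (\<forall>x k a. \<exists>y. entry' y k = a \<and> (\<forall>j. aless M j k \<longrightarrow> entry' y j = entry' x j))"
    by (rule transfer) (intro codefined_entry codefined_intros)
  moreover have "\<forall>x k a. \<exists>y. entry y k = a \<and> (\<forall>j. j < k \<longrightarrow> entry y j = entry x j)"
  proof (intro allI)
    fix x k a
    obtain y where "\<forall>i < Suc k. entry y i = (if i = k then a else entry x i)"
      using ex_entry[of "Suc k" "\<lambda>i. if i = k then a else entry x i"] by blast
    then have "entry y k = a \<and> (\<forall>j. j < k \<longrightarrow> entry y j = entry x j)"
      by auto
    then show "\<exists>y. entry y k = a \<and> (\<forall>j. j < k \<longrightarrow> entry y j = entry x j)"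
      by blast
  qed
  ultimately obtain y where "entry' y (std l) = v l"
    "\<And>j. aless M j (std l) \<Longrightarrow> entry' y j = entry' x j"
    by blast
  then have "\<forall>j<Suc l. env y j = v j"
    using x by (auto simp: env_def less_Suc_eq std_less)
  then show ?case ..
qed auto

lemma codefined_eval_tm:
  "codefined_fun (\<lambda>v. eval_tm std_nat (\<lambda>j. entry (v 0) j) t) (\<lambda>v. eval_tm M (env (v 0)) t)"
proof (induction t)
  case (Var x)
  show ?case
    unfolding eval_tm.simps env_def by (intro codefined_entry codefined_fun_var codefined_std)
next
  case Zero
  show ?case
    using codefined_zero by (simp add: std_nat_def)
next
  case One
  show ?case
    using codefined_one by (simp add: std_nat_def)
next
  case (Plus s t)
  then show ?case
    using codefined_plus by (simp add: std_nat_def)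
next
  case (Times s t)
  then show ?case
    using codefined_times by (simp add: std_nat_def)
qed

lemma holds'_0_Equal:
  "holds' 0 (std (pair 1 (pair (code_tm s) (code_tm t)))) x \<longleftrightarrow>
    eval_tm M (env x) s = eval_tm M (env x) t"
proof -
  have "(\<forall>x. holds 0 (pair 1 (pair (code_tm s) (code_tm t))) x \<longleftrightarrow>
      eval_tm std_nat (\<lambda>j. entry x j) s = eval_tm std_nat (\<lambda>j. entry x j) t) \<longleftrightarrow>
    (\<forall>x. holds' 0 (std (pair 1 (pair (code_tm s) (code_tm t)))) x \<longleftrightarrow>
      eval_tm M (env x) s = eval_tm M (env x) t)"
    by (rule transfer)
      (intro codefined_all codefined_iff codefined_holds codefined_std codefined_fun_var
        codefined_eq codefined_eval_tm)
  then show ?thesis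
    using holds_0_Equal by blast
qed

lemma holds'_0_Less:
  "holds' 0 (std (pair 2 (pair (code_tm s) (code_tm t)))) x \<longleftrightarrow>
    aless M (eval_tm M (env x) s) (eval_tm M (env x) t)"
proof -
  have "(\<forall>x. holds 0 (pair 2 (pair (code_tm s) (code_tm t))) x \<longleftrightarrow>
      eval_tm std_nat (\<lambda>j. entry x j) s < eval_tm std_nat (\<lambda>j. entry x j) t) \<longleftrightarrow>
    (\<forall>x. holds' 0 (std (pair 2 (pair (code_tm s) (code_tm t)))) x \<longleftrightarrow>
      aless M (eval_tm M (env x) s) (eval_tm M (env x) t))"
    by (rule transfer)
      (intro codefined_all codefined_iff codefined_holds codefined_std codefined_fun_var
        codefined_less codefined_eval_tm)
  then show ?thesis
    using holds_0_Less by blast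
qed

definition sim :: "nat \<Rightarrow> 'a \<Rightarrow> 'a \<Rightarrow> bool" where
  "sim n x y \<longleftrightarrow> (\<forall>i. holds' n (std i) x \<longleftrightarrow> holds' n (std i) y)"

lemma sim_sym: "sim n x y \<Longrightarrow> sim n y x"
  by (simp add: sim_def)

text \<open>By transferred induction, \<open>Q' x y\<close> either holds everywhere or holds at some
  \<open>k\<close> and fails at its successor; such a \<open>k\<close> is not standard, since all
  standard points satisfy \<open>Q'\<close>.\<close>

lemma overspill:
  assumes Q: "codefined (\<lambda>v. Q (v 0) (v 1) (v 2)) (\<lambda>v. Q' (v 0) (v 1) (v 2))"
    and std: "\<And>n. Q' x y (std n)"
    and nonstd: "a \<notin> range std"
  shows "\<exists>k. k \<notin> range std \<and> Q' x y k"
proof -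
  have "(\<forall>x y. Q x y 0 \<longrightarrow> (\<exists>k. Q x y k \<and> \<not> Q x y (k + 1)) \<or> (\<forall>k. Q x y k)) \<longleftrightarrow>
    (\<forall>x y. Q' x y (azero M) \<longrightarrow> (\<exists>k. Q' x y k \<and> \<not> Q' x y (aplus M k (aone M))) \<or> (\<forall>k. Q' x y k))"
    by (rule transfer) (intro codefined_rel3[of Q Q', OF Q] codefined_intros)
  moreover have "\<forall>x y. Q x y 0 \<longrightarrow> (\<exists>k. Q x y k \<and> \<not> Q x y (k + 1)) \<or> (\<forall>k. Q x y k)"
    by (metis Suc_eq_plus1 nat_induct)
  moreover have "Q' x y (azero M)"
    using std[of 0] by simp
  ultimately consider k where "Q' x y k" "\<not> Q' x y (aplus M k (aone M))" | "\<forall>k. Q' x y k"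
    by blast
  then show ?thesis
  proof cases
    case 1
    have "k \<noteq> std n" for n
      using 1(2) std[of "Suc n"] by auto
    then show ?thesis
      using 1(1) by blast
  qed (use nonstd in blast)
qed

text \<open>For each standard \<open>k\<close>, having a companion that agrees with
  \<open>x'\<close> on indices below \<open>k\<close> is one standard instance of
  \<open>holds (Suc n)\<close>, so it passes from \<open>x\<close> to \<open>y\<close>. The
  companion may vary with \<open>k\<close>; overspill yields one that serves all standard indices.
  \<open>A\<close> holds the variables to be kept.\<close>

lemma back_and_forth:
  assumes sim: "sim (Suc n) x y" and nonstd: "a \<notin> range std"
    and x': "\<And>j. j < l \<Longrightarrow> j \<in> A \<Longrightarrow> env x' j = env x j"
  shows "\<exists>y'. (\<forall>j<l. j \<in> A \<longrightarrow> env y' j = env y j) \<and> sim n x' y'"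
proof -
  obtain z where z: "\<And>j. j < l \<Longrightarrow> elem j z \<longleftrightarrow> j \<in> A"
    using ex_elem[of l "\<lambda>j. j \<in> A"] by blast
  define Q where "Q x' y k \<longleftrightarrow> (\<exists>y'. (\<forall>j. j < l \<longrightarrow> elem j z \<longrightarrow> entry y' j = entry y j) \<and>
    (\<forall>i. i < k \<longrightarrow> (holds n i x' \<longleftrightarrow> holds n i y')))" for x' y k
  define Q' where "Q' x' y k \<longleftrightarrow>
    (\<exists>y'. (\<forall>j. aless M j (std l) \<longrightarrow> elem' j (std z) \<longrightarrow> entry' y' j = entry' y j) \<and>
    (\<forall>i. aless M i k \<longrightarrow> (holds' n i x' \<longleftrightarrow> holds' n i y')))" for x' y k
  have Q: "codefined (\<lambda>v. Q (v 0) (v 1) (v 2)) (\<lambda>v. Q' (v 0) (v 1) (v 2))"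
    unfolding Q_def Q'_def
    by (intro codefined_elem codefined_entry codefined_holds codefined_intros)
  \<comment> \<open>Below \<open>std l\<close> there are only standard indices, so the quantifier
    inside \<open>M\<close> equals the one outside.\<close>
  have agree: "(\<forall>j. aless M j (std l) \<longrightarrow> elem' j (std z) \<longrightarrow> entry' u j = entry' w j) \<longleftrightarrow>
      (\<forall>j<l. j \<in> A \<longrightarrow> env u j = env w j)" for u w
    using less_std_imp_std[of _ l] by (fastforce simp: std_less elem'_std z env_def)
  have "Q' x' y (std k)" for k
  proof -
    \<comment> \<open>Though it records truth in \<open>M\<close>, this piece of type has only
      \<open>k\<close> bits, so a natural number \<open>t\<close> codes it and \<open>s\<close> is a
      standard index.\<close>
    obtain t where t: "\<And>i. i < k \<Longrightarrow> elem i t \<longleftrightarrow> holds' n (std i) x'"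
      using ex_elem[of k "\<lambda>i. holds' n (std i) x'"] by blast
    define s where "s = pair l (pair z (pair k t))"
    have "(\<forall>x. holds (Suc n) s x \<longleftrightarrow> (\<exists>y. (\<forall>j. j < l \<longrightarrow> elem j z \<longrightarrow> entry y j = entry x j) \<and>
        (\<forall>i. i < k \<longrightarrow> (elem i t \<longleftrightarrow> holds n i y)))) \<longleftrightarrow>
      (\<forall>x. holds' (Suc n) (std s) x \<longleftrightarrow>
        (\<exists>y. (\<forall>j. aless M j (std l) \<longrightarrow> elem' j (std z) \<longrightarrow> entry' y j = entry' x j) \<and>
        (\<forall>i. aless M i (std k) \<longrightarrow> (elem' i (std t) \<longleftrightarrow> holds' n i y))))"
      by (rule transfer) (intro codefined_elem codefined_entry codefined_holds codefined_intros)
    moreover have "\<forall>x. holds (Suc n) s x \<longleftrightarrow>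
      (\<exists>y. (\<forall>j. j < l \<longrightarrow> elem j z \<longrightarrow> entry y j = entry x j) \<and>
        (\<forall>i. i < k \<longrightarrow> (elem i t \<longleftrightarrow> holds n i y)))"
      by (simp add: s_def pair_inject)
    ultimately have holds': "holds' (Suc n) (std s) x \<longleftrightarrow>
        (\<exists>y. (\<forall>j<l. j \<in> A \<longrightarrow> env y j = env x j) \<and>
        (\<forall>i. aless M i (std k) \<longrightarrow> (elem' i (std t) \<longleftrightarrow> holds' n i y)))" for x
      unfolding agree by blast
    have "elem' i (std t) \<longleftrightarrow> holds' n i x'" if "aless M i (std k)" for i
      using less_std_imp_std[OF that] t by (auto simp: elem'_std)
    then have "holds' (Suc n) (std s) x"
      unfolding holds' using x' by (intro exI[of _ x']) auto
    then have "holds' (Suc n) (std s) y"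
      using sim by (simp add: sim_def)
    then obtain y' where y': "\<forall>j<l. j \<in> A \<longrightarrow> env y' j = env y j"
      "\<And>i. aless M i (std k) \<Longrightarrow> elem' i (std t) \<longleftrightarrow> holds' n i y'"
      unfolding holds' by blast
    then show ?thesis
      unfolding Q'_def agree
      using \<open>\<And>i. aless M i (std k) \<Longrightarrow> elem' i (std t) \<longleftrightarrow> holds' n i x'\<close> by blast
  qed
  then obtain k where "k \<notin> range std" "Q' x' y k"
    using overspill[OF Q _ nonstd] by blast
  then obtain y' where y': "\<forall>j<l. j \<in> A \<longrightarrow> env y' j = env y j"
    "\<And>i. aless M i k \<Longrightarrow> holds' n i x' \<longleftrightarrow> holds' n i y'"
    unfolding Q'_def agree by blast
  have "sim n x' y'"
    unfolding sim_def using y'(2) std_less_nonstandard[OF \<open>k \<notin> range std\<close>] by blast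
  then show ?thesis
    using y'(1) by blast
qed

text \<open>Finitely many free variables allow an environment to be replaced by a code. One
  implication is enough, since \<open>sim n\<close> is symmetric.\<close>

definition preserved :: "nat \<Rightarrow> fm \<Rightarrow> bool" where
  "preserved n p \<longleftrightarrow>
     (finite (free_vars p) \<longrightarrow> (\<forall>x y. sim n x y \<longrightarrow> sat M (env x) p \<longrightarrow> sat M (env y) p))"

lemma preserved_Neg: "preserved n p \<Longrightarrow> preserved n (Neg p)"
  by (auto simp: preserved_def dest: sim_sym)

lemma preserved_quantifier_free:
  "finitary p \<Longrightarrow> quantifier_free p \<Longrightarrow> preserved 0 p"
proof (induction p)
  case (Equal s t)
  show ?case
    unfolding preserved_def sim_def sat.simps holds'_0_Equal[symmetric] by blast
next
  case (Less s t)
  show ?case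
    unfolding preserved_def sim_def sat.simps holds'_0_Less[symmetric] by blast
next
  case (Neg p)
  then show ?case
    by (simp add: preserved_Neg)
qed (auto simp: preserved_def)

text \<open>A block of any finite length costs a single level, because all its witnesses are packed
  into one code \<open>x'\<close>.\<close>

lemma preserved_Exists:
  assumes p: "preserved n p" and nonstd: "a \<notin> range std"
  shows "preserved (Suc n) (foldr Exists xs p)"
  unfolding preserved_def
proof (intro impI allI)
  fix x y
  assume fin: "finite (free_vars (foldr Exists xs p))" and sim: "sim (Suc n) x y"
    and sat: "sat M (env x) (foldr Exists xs p)"
  have fin_p: "finite (free_vars p)"
    using fin by simp
  then obtain l where l: "free_vars p \<subseteq> {..<l}"
    using finite_nat_iff_bounded by blast
  obtain w where w: "\<And>i. i \<notin> set xs \<Longrightarrow> w i = env x i" "sat M w p"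
    using sat unfolding sat_foldr_Exists by blast
  obtain x' where x': "\<And>j. j < l \<Longrightarrow> env x' j = w j"
    using ex_env by blast
  have "sat M (env x') p"
    using w(2) sat_cong[of p "env x'" w M] x' l by auto
  obtain y' where y': "\<And>j. j < l \<Longrightarrow> j \<notin> set xs \<Longrightarrow> env y' j = env y j" "sim n x' y'"
    using back_and_forth[OF sim nonstd, of l "- set xs" x'] w(1) x' by auto
  have "sat M (env y') p"
    using p fin_p y'(2) \<open>sat M (env x') p\<close> by (auto simp: preserved_def)
  \<comment> \<open>\<open>y'\<close> agrees with \<open>y\<close> only on the kept variables below
    \<open>l\<close>; \<open>w'\<close> restores the values of \<open>y\<close> everywhere outside
    the block.\<close>
  define w' where "w' i = (if i \<in> set xs then env y' i else env y i)" for i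
  have "sat M w' p \<longleftrightarrow> sat M (env y') p"
    by (rule sat_cong) (use y'(1) l in \<open>auto simp: w'_def\<close>)
  then show "sat M (env y) (foldr Exists xs p)"
    unfolding sat_foldr_Exists using \<open>sat M (env y') p\<close>
    by (intro exI[of _ w']) (auto simp: w'_def)
qed

lemma preserved_Forall:
  assumes "preserved n p" "a \<notin> range std"
  shows "preserved (Suc n) (foldr Forall xs p)"
  using preserved_Neg[OF preserved_Exists[OF preserved_Neg[OF assms(1)] assms(2)], of xs]
  by (simp add: preserved_def sat_foldr_Forall)

text \<open>The empty list is also a quantifier block, so each step up is an instance of
  \<open>preserved_Exists\<close>.\<close>

lemma preserved_mono:
  assumes "preserved m p" "a \<notin> range std" "m \<le> n"
  shows "preserved n p"
  using assms(3)
proof (induction n rule: dec_induct)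
  case base
  show ?case by fact
next
  case (step n)
  then show ?case
    using preserved_Exists[OF _ assms(2), of n p "[]"] by simp
qed

lemma preserved_BigDisj:
  assumes "\<And>i. preserved n (ps i)"
  shows "preserved n (BigDisj ps)"
proof -
  have "finite (free_vars (ps i))" if "finite (\<Union>i. free_vars (ps i))" for i
    by (rule finite_subset[OF _ that]) blast
  then show ?thesis
    using assms unfolding preserved_def free_vars.simps sat.simps by blast
qed

lemma preserved_BigConj:
  assumes "\<And>i. preserved n (ps i)"
  shows "preserved n (BigConj ps)"
proof -
  have "finite (free_vars (ps i))" if "finite (\<Union>i. free_vars (ps i))" for i
    by (rule finite_subset[OF _ that]) blast
  then show ?thesis
    using assms unfolding preserved_def free_vars.simps sat.simps by blast
qed

text \<open>One \<open>n\<close> serves all formulas of the level: only finitely many levels lie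
  below \<open>\<alpha>\<close>, so their bounds have a maximum, and the outer block adds
  one.\<close>

lemma preserved_below_omega:
  assumes "\<alpha> < omega" and nonstd: "a \<notin> range std"
  shows "\<exists>n. \<forall>p. Sigma_in \<alpha> p \<or> Pi_in \<alpha> p \<longrightarrow> preserved n p"
  using assms(1)
proof (induction \<alpha> rule: less_induct)
  case (less \<alpha>)
  then have "\<forall>\<beta>. \<exists>n. \<beta> < \<alpha> \<longrightarrow> (\<forall>p. Sigma_in \<beta> p \<or> Pi_in \<beta> p \<longrightarrow> preserved n p)"
    using order.strict_trans by blast
  from choice[OF this] obtain N where
    N: "\<And>\<beta> p. \<beta> < \<alpha> \<Longrightarrow> Sigma_in \<beta> p \<or> Pi_in \<beta> p \<Longrightarrow> preserved (N \<beta>) p"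
    by blast
  define n where "n = Max (insert 0 (N ` {\<beta>. \<beta> < \<alpha>}))"
  have "N \<beta> \<le> n" if "\<beta> < \<alpha>" for \<beta>
    unfolding n_def using that finite_below_omega[OF less.prems] by (intro Max_ge) auto
  then have pres: "preserved n p" if "\<beta> < \<alpha>" "Sigma_in \<beta> p \<or> Pi_in \<beta> p" for \<beta> p
    using N[OF that] preserved_mono[OF _ nonstd] that(1) by blast
  have "preserved (Suc n) p" if "Sigma_in \<alpha> p" for p
    using that
  proof cases
    case Sigma_zero
    then show ?thesis
      using preserved_mono[OF preserved_quantifier_free nonstd] by blast
  next
    case (Sigma_step \<beta> ps xs)
    have "preserved (Suc n) (foldr Exists (xs i) (ps i))" for i
      using Sigma_step(2,3) pres nonstd by (intro preserved_Exists) blast+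
    then show ?thesis
      unfolding Sigma_step(1) by (rule preserved_BigDisj)
  qed
  moreover have "preserved (Suc n) p" if "Pi_in \<alpha> p" for p
    using that
  proof cases
    case Pi_zero
    then show ?thesis
      using preserved_mono[OF preserved_quantifier_free nonstd] by blast
  next
    case (Pi_step \<beta> ps xs)
    have "preserved (Suc n) (foldr Forall (xs i) (ps i))" for i
      using Pi_step(2,3) pres nonstd by (intro preserved_Forall) blast+
    then show ?thesis
      unfolding Pi_step(1) by (rule preserved_BigConj)
  qed
  ultimately show ?case
    by blast
qed

end

section \<open>Nonstandard elements with equal types in different orbits\<close>

text \<open>Pigeonhole: the exceptional \<open>x\<close> are the first of their pattern on
  \<open>V 0\<close>, ..., \<open>V (k - 1)\<close>, and there are finitely many patterns.\<close>

lemma agreeing_predecessors: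
  fixes V :: "nat \<Rightarrow> nat \<Rightarrow> bool"
  shows "\<exists>m. \<forall>x>m. \<exists>z<x. \<forall>i<k. V i x \<longleftrightarrow> V i z"
proof -
  define S where "S = {x. \<not> (\<exists>z<x. \<forall>i<k. V i x \<longleftrightarrow> V i z)}"
  have "inj_on (\<lambda>x. {i \<in> {..<k}. V i x}) S"
  proof (rule inj_onI)
    fix x y assume xy: "x \<in> S" "y \<in> S" and "{i \<in> {..<k}. V i x} = {i \<in> {..<k}. V i y}"
    then have "\<forall>i<k. V i x \<longleftrightarrow> V i y"
      by blast
    then show "x = y"
      using xy linorder_less_linear[of x y] unfolding S_def by blast
  qed
  moreover have "finite ((\<lambda>x. {i \<in> {..<k}. V i x}) ` S)"
    by (rule finite_subset[of _ "Pow {..<k}"]) auto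
  ultimately have "finite S"
    by (rule finite_imageD[rotated])
  then obtain m where "\<forall>x\<in>S. x \<le> m"
    using finite_nat_set_iff_bounded_le by blast
  then have "\<forall>x>m. x \<notin> S"
    by (meson not_le)
  then show ?thesis
    unfolding S_def by blast
qed

text \<open>The cap \<open>k < x + 1\<close> makes a longest agreement exist; growing with
  \<open>x\<close>, it eventually admits every fixed length.\<close>

definition best_match :: "(nat \<Rightarrow> nat \<Rightarrow> bool) \<Rightarrow> nat \<Rightarrow> nat \<Rightarrow> bool" where
  "best_match V x y \<longleftrightarrow> y < x \<and> (\<forall>z. z < x \<longrightarrow> (\<forall>k. k < x + 1 \<longrightarrow>
     (\<forall>i. i < k \<longrightarrow> (V i x \<longleftrightarrow> V i z)) \<longrightarrow> (\<forall>i. i < k \<longrightarrow> (V i x \<longleftrightarrow> V i y))))"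

lemma ex_best_match:
  assumes "0 < x"
  shows "\<exists>y. best_match V x y"
proof -
  define K where "K = {k. k \<le> x \<and> (\<exists>y<x. \<forall>i<k. V i x \<longleftrightarrow> V i y)}"
  have "finite K"
    by (rule finite_subset[of _ "{..x}"]) (auto simp: K_def)
  have "0 \<in> K"
    using assms by (auto simp: K_def)
  then have "Max K \<in> K"
    using Max_in[OF \<open>finite K\<close>] by blast
  then obtain y where y: "y < x" "\<forall>i<Max K. V i x \<longleftrightarrow> V i y"
    by (auto simp: K_def)
  have "\<forall>i<k. V i x \<longleftrightarrow> V i y" if "z < x" "k < x + 1" "\<forall>i<k. V i x \<longleftrightarrow> V i z" for z k
  proof -
    have "k \<in> K"
      using that by (auto simp: K_def)
    then have "k \<le> Max K"
      using Max_ge[OF \<open>finite K\<close>] by blast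
    then show ?thesis
      using y(2) by auto
  qed
  then show ?thesis
    unfolding best_match_def using y(1) by blast
qed

definition match :: "(nat \<Rightarrow> nat \<Rightarrow> bool) \<Rightarrow> nat \<Rightarrow> nat \<Rightarrow> bool" where
  "match V x y \<longleftrightarrow> best_match V x y \<and> (\<forall>z. z < y \<longrightarrow> \<not> best_match V x z)"

lemma ex1_match:
  assumes "0 < x"
  shows "\<exists>!y. match V x y"
proof (rule ex_ex1I)
  show "\<exists>y. match V x y"
    using LeastI_ex[OF ex_best_match[OF assms, of V]] not_less_Least unfolding match_def by blast
  show "y = z" if "match V x y" "match V x z" for y z
    using that linorder_less_linear[of y z] unfolding match_def by blast
qed

lemma match_less: "match V x y \<Longrightarrow> y < x"
  by (simp add: match_def best_match_def)

lemma match_agrees: "\<exists>m. \<forall>x>m. \<forall>y. match V x y \<longrightarrow> (V i x \<longleftrightarrow> V i y)"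
proof -
  obtain m where m: "\<And>x. x > m \<Longrightarrow> \<exists>z<x. \<forall>j<Suc i. V j x \<longleftrightarrow> V j z"
    using agreeing_predecessors[of "Suc i" V] by blast
  \<comment> \<open>Beyond \<open>m\<close> some predecessor agrees on the first
    \<open>Suc i\<close> relations; adding \<open>i\<close> brings that length under the cap in
    \<open>best_match\<close>.\<close>
  have "V i x \<longleftrightarrow> V i y" if "x > m + i" "match V x y" for x y
  proof -
    obtain z where z: "z < x" "\<forall>j. j < Suc i \<longrightarrow> (V j x \<longleftrightarrow> V j z)"
      using m[of x] \<open>x > m + i\<close> by auto
    have "Suc i < x + 1"
      using \<open>x > m + i\<close> by simp
    then have "\<forall>j. j < Suc i \<longrightarrow> (V j x \<longleftrightarrow> V j y)"
      using \<open>match V x y\<close> z unfolding match_def best_match_def by blast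
    then show ?thesis
      by simp
  qed
  then show ?thesis
    by blast
qed

text \<open>Matches form a tree rooted at 0, and the colour is the parity of the depth. The
  recursion is replaced by a coded set \<open>s\<close> that obeys it below
  \<open>k\<close>.\<close>

definition colouring :: "(nat \<Rightarrow> nat \<Rightarrow> bool) \<Rightarrow> nat \<Rightarrow> nat \<Rightarrow> bool" where
  "colouring V s k \<longleftrightarrow> (\<forall>x. x < k \<longrightarrow> (elem x s \<longleftrightarrow> (\<exists>y. match V x y \<and> \<not> elem y s)))"

lemma ex_colouring: "\<exists>s. colouring V s k"
proof (induction k)
  case 0
  show ?case
    by (simp add: colouring_def)
next
  case (Suc k)
  then obtain s where s: "colouring V s k"
    by blast
  obtain s' where "\<forall>i<Suc k. elem i s' \<longleftrightarrow> (if i < k then elem i s else \<exists>y. match V k y \<and> \<not> elem y s)"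
    using ex_elem[of "Suc k" "\<lambda>i. if i < k then elem i s else \<exists>y. match V k y \<and> \<not> elem y s"] by blast
  then have s': "\<And>i. i < k \<Longrightarrow> elem i s' \<longleftrightarrow> elem i s" "elem k s' \<longleftrightarrow> (\<exists>y. match V k y \<and> \<not> elem y s)"
    by auto
  have "elem x s' \<longleftrightarrow> (\<exists>y. match V x y \<and> \<not> elem y s')" if "x < Suc k" for x
  proof -
    have "elem x s' \<longleftrightarrow> (\<exists>y. match V x y \<and> \<not> elem y s)"
      using that s s' unfolding colouring_def by (cases "x = k") auto
    moreover have "elem y s' \<longleftrightarrow> elem y s" if "match V x y" for y
      using match_less[OF that] \<open>x < Suc k\<close> s'(1) by simp
    ultimately show ?thesis
      by blast
  qed
  then show ?case
    unfolding colouring_def by blast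
qed

lemma colouring_unique:
  assumes "colouring V s k" "colouring V s' k'" "x < k" "x < k'"
  shows "elem x s \<longleftrightarrow> elem x s'"
  using assms(3,4)
proof (induction x rule: less_induct)
  case (less x)
  have "elem y s \<longleftrightarrow> elem y s'" if "match V x y" for y
    using less match_less[OF that] by simp
  then show ?case
    using assms(1,2) less.prems unfolding colouring_def by blast
qed

definition coloured :: "(nat \<Rightarrow> nat \<Rightarrow> bool) \<Rightarrow> nat \<Rightarrow> bool" where
  "coloured V x \<longleftrightarrow> (\<exists>s. colouring V s (x + 1) \<and> elem x s)"

lemma coloured_iff: "colouring V s k \<Longrightarrow> x < k \<Longrightarrow> coloured V x \<longleftrightarrow> elem x s"
  unfolding coloured_def using ex_colouring[of V "x + 1"] colouring_unique[of V _ "x + 1" s k x]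
  by auto

lemma coloured_match:
  assumes "match V x y"
  shows "coloured V x \<noteq> coloured V y"
proof -
  obtain s where s: "colouring V s (x + 1)"
    using ex_colouring by blast
  have "y < x"
    using match_less[OF assms] .
  then have "coloured V x \<longleftrightarrow> elem x s" "coloured V y \<longleftrightarrow> elem y s"
    using coloured_iff[OF s] by auto
  moreover have "elem x s \<longleftrightarrow> \<not> elem y s"
  proof -
    have "\<exists>!y. match V x y"
      using \<open>y < x\<close> by (intro ex1_match) simp
    then show ?thesis
      using s assms unfolding colouring_def by (metis less_add_one)
  qed
  ultimately show ?thesis
    by simp
qed

context true_arith_model
begin

text \<open>In \<open>N\<close>, all but finitely many \<open>x\<close> agree with their match on \<open>V i\<close>. Hence a nonstandard element
  agrees with its match on \<open>V i\<close> for every standard \<open>i\<close>, yet the two differ in colour.\<close>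

lemma same_standard_type_not_conjugate:
  assumes V: "codefined (\<lambda>v. V (v 0) (v 1)) (\<lambda>v. V' (v 0) (v 1))"
    and nonstd: "a \<notin> range std"
  shows "\<exists>b. (\<forall>i. V' (std i) a \<longleftrightarrow> V' (std i) b) \<and> (\<forall>f. isomorphism M M f \<longrightarrow> f a \<noteq> b)"
proof -
  have ar_V: "arithmetical (\<lambda>v. V (s v) (t v))" if "arithmetical_fun s" "arithmetical_fun t" for s t
    by (rule arithmetical_rel2[OF _ that]) (use V arithmetical_def in blast)
  have ar_best: "arithmetical (\<lambda>v. best_match V (s v) (t v))"
    if "arithmetical_fun s" "arithmetical_fun t" for s t
    by (rule arithmetical_rel2[OF _ that], unfold best_match_def)
      (intro ar_V arithmetical_intros)
  have ar_match: "arithmetical (\<lambda>v. match V (s v) (t v))"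
    if "arithmetical_fun s" "arithmetical_fun t" for s t
    by (rule arithmetical_rel2[OF _ that], unfold match_def)
      (intro ar_best arithmetical_intros)
  have "arithmetical (\<lambda>v. coloured V (v 0))"
    unfolding coloured_def colouring_def by (intro ar_match arithmetical_elem arithmetical_intros)
  then obtain D where D: "codefined (\<lambda>v. coloured V (v 0)) (\<lambda>v. D (v 0))"
    by (rule arithmetical_extension1)
  have "arithmetical (\<lambda>v. match V (v 0) (v 1))"
    by (intro ar_match arithmetical_var)
  then obtain G where G: "codefined (\<lambda>v. match V (v 0) (v 1)) (\<lambda>v. G (v 0) (v 1))"
    by (rule arithmetical_extension2)
  note rules = codefined_rel2[of V V', OF V] codefined_rel2[of "match V" G, OF G]
    codefined_rel1[of "coloured V" D, OF D] codefined_intros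
  have "(\<forall>x. 0 < x \<longrightarrow> (\<exists>y. match V x y)) \<longleftrightarrow> (\<forall>x. aless M (azero M) x \<longrightarrow> (\<exists>y. G x y))"
    by (rule transfer) (intro rules)
  moreover have "\<forall>x. 0 < x \<longrightarrow> (\<exists>y. match V x y)"
    using ex1_match by blast
  \<comment> \<open>A nonstandard element is positive, so \<open>a\<close> has a match
    \<open>b\<close> in the sense of \<open>M\<close>.\<close>
  moreover have "aless M (azero M) a"
    using std_less_nonstandard[OF nonstd, of 0] by simp
  ultimately obtain b where b: "G a b"
    by blast
  have "(\<forall>x y. match V x y \<longrightarrow> \<not> (coloured V x \<longleftrightarrow> coloured V y)) \<longleftrightarrow>
      (\<forall>x y. G x y \<longrightarrow> \<not> (D x \<longleftrightarrow> D y))"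
    by (rule transfer) (intro rules)
  then have neq: "D a \<noteq> D b"
    using coloured_match b by blast
  have "V' (std i) a \<longleftrightarrow> V' (std i) b" for i
  proof -
    obtain m where "\<forall>x>m. \<forall>y. match V x y \<longrightarrow> (V i x \<longleftrightarrow> V i y)"
      using match_agrees by blast
    moreover have "(\<forall>x. m < x \<longrightarrow> (\<forall>y. match V x y \<longrightarrow> (V i x \<longleftrightarrow> V i y))) \<longleftrightarrow>
      (\<forall>x. aless M (std m) x \<longrightarrow> (\<forall>y. G x y \<longrightarrow> (V' (std i) x \<longleftrightarrow> V' (std i) y)))"
      by (rule transfer) (intro rules)
    ultimately show ?thesis
      using b std_less_nonstandard[OF nonstd, of m] by blast
  qed
  moreover have "f a \<noteq> b" if f: "isomorphism M M f" for f
  proof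
    assume fa: "f a = b"
    \<comment> \<open>\<open>D\<close> is defined in \<open>M\<close> by a finitary formula, so no
      automorphism moves \<open>a\<close> to an element of the other colour.\<close>
    obtain p where p: "\<And>v. sat M v p \<longleftrightarrow> D (v 0)"
      using D by (auto simp: codefined_def)
    have "D (f a) \<longleftrightarrow> D a"
      using sat_isomorphism[OF f, of "\<lambda>_. a" p] by (simp add: p)
    then show False
      using neq fa by simp
  qed
  ultimately show ?thesis
    by blast
qed

lemma orbit_not_Sigma_omega:
  assumes nonstd: "a \<notin> range std" and "\<alpha> \<le> omega" "Sigma_in \<alpha> p"
  shows "\<not> defined_by M 1 p (orbit M [a])"
proof
  assume def: "defined_by M 1 p (orbit M [a])"
  then have fv: "free_vars p \<subseteq> {..<1}" and orb: "orbit M [a] = {map v [0..<1] | v. sat M v p}"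
    by (auto simp: defined_by_def)
  have "isomorphism M M id"
    by (simp add: isomorphism_def)
  then have "[a] \<in> orbit M [a]"
    unfolding orbit_def mem_Collect_eq by (intro exI[of _ id]) simp
  then obtain v where v: "v 0 = a" "sat M v p"
    unfolding orb by auto
  \<comment> \<open>At level \<omega> the levels of the disjuncts may be unbounded. A single
    disjunct true at \<open>v\<close> has a finite level and implies \<open>p\<close>, which is all
    that is needed to put a further element into the orbit.\<close>
  have "\<exists>n q. preserved n q \<and> free_vars q \<subseteq> {..<1} \<and> sat M v q \<and> (\<forall>w. sat M w q \<longrightarrow> sat M w p)"
    using assms(3)
  proof cases
    case Sigma_zero
    then show ?thesis
      using preserved_quantifier_free fv v(2) by blast
  next
    case (Sigma_step \<beta> ps xs)
    obtain i where i: "sat M v (foldr Exists (xs i) (ps i))"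
      using v(2) unfolding Sigma_step(1) by auto
    have "\<beta> i < omega"
      using Sigma_step(2) assms(2) less_le_trans by blast
    then obtain n where "preserved n (ps i)"
      using preserved_below_omega[OF _ nonstd] Sigma_step(3) by blast
    then have "preserved (Suc n) (foldr Exists (xs i) (ps i))"
      using nonstd by (rule preserved_Exists)
    moreover have "free_vars (foldr Exists (xs i) (ps i)) \<subseteq> {..<1}"
      using fv unfolding Sigma_step(1) by auto
    moreover have "\<forall>w. sat M w (foldr Exists (xs i) (ps i)) \<longrightarrow> sat M w p"
      unfolding Sigma_step(1) by auto
    ultimately show ?thesis
      using i by blast
  qed
  then obtain n q where q: "preserved n q" "free_vars q \<subseteq> {..<1}" "sat M v q"
    "\<And>w. sat M w q \<Longrightarrow> sat M w p"
    by blast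
  \<comment> \<open>Many codes share the entry 0. Taking the least one attaches to each element
    \<open>u\<close> a definable code, so that a type of codes becomes a type of elements.\<close>
  define C where "C x u \<longleftrightarrow> entry x 0 = u \<and> (\<forall>y. y < x \<longrightarrow> \<not> entry y 0 = u)" for x u
  define C' where "C' x u \<longleftrightarrow> entry' x (azero M) = u \<and>
    (\<forall>y. aless M y x \<longrightarrow> \<not> entry' y (azero M) = u)" for x u
  have C: "codefined (\<lambda>v. C (v 0) (v 1)) (\<lambda>v. C' (v 0) (v 1))"
    unfolding C_def C'_def by (intro codefined_entry codefined_intros)
  have "(\<forall>u. \<exists>x. C x u) \<longleftrightarrow> (\<forall>u. \<exists>x. C' x u)"
    by (rule transfer) (intro codefined_rel2[of C C', OF C] codefined_intros)
  moreover have "\<exists>x. C x u" for u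
  proof -
    have "\<exists>x. entry x 0 = u"
      using ex_entry[of 1 "\<lambda>_. u"] by auto
    from LeastI_ex[OF this] show ?thesis
      unfolding C_def using not_less_Least[of _ "\<lambda>x. entry x 0 = u"] by blast
  qed
  ultimately have ex_C': "\<exists>x. C' x u" for u
    by blast
  have C'_unique: "x = y" if "C' x u" "C' y u" for x y u
    using that less_linear[of x y] unfolding C'_def by blast
  have C'_env: "env x 0 = u" if "C' x u" for x u
    using that by (simp add: C'_def env_def)
  \<comment> \<open>Since the code is unique, agreement of \<open>a\<close> and \<open>b\<close> on
    the standard \<open>V'\<close>-type is exactly \<open>sim n\<close> for their codes.\<close>
  define V where "V i u \<longleftrightarrow> (\<exists>x. C x u \<and> holds n i x)" for i u
  define V' where "V' i u \<longleftrightarrow> (\<exists>x. C' x u \<and> holds' n i x)" for i u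
  have "codefined (\<lambda>v. V (v 0) (v 1)) (\<lambda>v. V' (v 0) (v 1))"
    unfolding V_def V'_def
    by (intro codefined_rel2[of C C', OF C] codefined_holds codefined_intros)
  then obtain b where b: "\<And>i. V' (std i) a \<longleftrightarrow> V' (std i) b" "\<And>f. isomorphism M M f \<Longrightarrow> f a \<noteq> b"
    using same_standard_type_not_conjugate[of V V', OF _ nonstd] by blast
  obtain x y where xy: "C' x a" "C' y b"
    using ex_C' by blast
  have "sim n x y"
    unfolding sim_def using b(1) xy C'_unique unfolding V'_def by metis
  moreover have "sat M (env x) q"
  proof -
    have "env x j = v j" if "j \<in> free_vars q" for j
      using that q(2) C'_env[OF xy(1)] v(1) by auto
    then show ?thesis
      using q(3) sat_cong[of q "env x" v M] by blast
  qed
  moreover have "finite (free_vars q)"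
    using q(2) finite_subset by blast
  ultimately have "sat M (env y) q"
    using q(1) unfolding preserved_def by blast
  then have "map (env y) [0..<1] \<in> orbit M [a]"
    unfolding orb using q(4) by blast
  then obtain f where "isomorphism M M f" "f a = b"
    using C'_env[OF xy(2)] by (auto simp: orbit_def)
  then show False
    using b(2) by blast
qed

end

theorem theorem1p7:
  fixes M :: "'a arith"
  assumes "countable (UNIV :: 'a set)"
    and "is_model M true_arithmetic"
    and "nonstandard M"
  shows "Scott_rank M > omega"
proof (rule ccontr)
  interpret true_arith_model M
    by unfold_locales (rule assms(2))
  assume "\<not> Scott_rank M > omega"
  then have "Scott_rank M \<le> omega"
    by simp
  moreover have "\<forall>a. \<exists>p. Sigma_in (Scott_rank M) p \<and> defined_by M (length a) p (orbit M a)"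
    unfolding Scott_rank_def by (rule LeastI_ex) (rule ex_Scott_rank[OF assms(1)])
  moreover obtain a where "a \<notin> range std"
    using ex_nonstandard[OF assms(3)] by blast
  ultimately show False
    using orbit_not_Sigma_omega[of a "Scott_rank M"] by (metis length_Cons list.size(3) One_nat_def)
qed

end
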